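(* Let $n\ge1$, $\alpha^2,\nu,t_0>0$, $\boldsymbol\beta\in\mathbb{R}^n$, and consider the inverse problem of determining the source $f\in L^2(\mathbb{R}^n)$ in $$u_t=\alpha^2\Delta u-\boldsymbol\beta\cdot\nabla u-\nu u+f(\mathbf{x}),\quad \mathbf{x}\in\mathbb{R}^n,\ t>0,\qquad u(\mathbf{x},0)=0,\qquad u(\mathbf{x},t_0)=y(\mathbf{x}),\quad \mathbf{x}\in\mathbb{R}^n,$$ with $u(\cdot,t)\in L^2(\mathbb{R}^n)$ and $y\in L^2(\mathbb{R}^n)$, from noisy data $y_\delta\in L^2(\mathbb{R}^n)$ satisfying $\|y-y_\delta\|_{L^2(\mathbb{R}^n)}\le\delta$, where $0<\delta\le\delta_M$. For $\mu>0$ let $f_{\delta,\mu}$ be the regularized solution, i.e. the inverse Fourier transform of $$\hat f_{\delta,\mu}(\boldsymbol\xi)=\frac{\Lambda(\boldsymbol\xi)}{1+\mu^2\|\boldsymbol\xi\|^2}\,\hat y_\delta(\boldsymbol\xi),\qquad \Lambda(\boldsymbol\xi)=\frac{z(\boldsymbol\xi)}{1-e^{-z(\boldsymbol\xi)t_0}},\qquad z(\boldsymbol\xi)=\alpha^2\|\boldsymbol\xi\|^2+i\,\boldsymbol\beta\cdot\boldsymbol\xi+\nu .$$ Assume that $\|f\|_{H^p(\mathbb{R}^n)}<C$ for some $0<p<\infty$. Then, choosing $\mu>0$ with $$\mu^2=\left(\frac{\delta}{C}\right)^{\frac{2}{p+2}},$$ we have $$\|f-f_{\delta,\mu}\|_{L^2(\mathbb{R}^n)}\le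 2\,\delta^{\frac{p}{p+2}}C^{\frac{2}{p+2}}\left[M+\frac12\max\left\{1,\left(\frac{\delta}{C}\right)^{\frac{2-p}{p+2}}\right\}\right],$$ where $$M=\max\left\{\frac1{t_0}+\frac{\sqrt n\,\|\boldsymbol\beta\|_\infty}{2\nu t_0},\ \nu+\alpha^2+\frac{\sqrt n\,\|\boldsymbol\beta\|_\infty}{2}\right\},\qquad \|\boldsymbol\beta\|_\infty=\max_{1\le j\le n}|\beta_j| .$$
   Context: The Fourier transform is $\hat g(\boldsymbol\xi)=(2\pi)^{-n/2}\int_{\mathbb{R}^n}e^{-i\boldsymbol\xi\cdot\mathbf{x}}g(\mathbf{x})\,d\mathbf{x}$ for $g\in L^2(\mathbb{R}^n)$. The Sobolev norm is $\|f\|_{H^p(\mathbb{R}^n)}=\left(\int_{\mathbb{R}^n}|\hat f(\boldsymbol\xi)|^2(1+\|\boldsymbol\xi\|^2)^p\,d\boldsymbol\xi\right)^{1/2}$, with $\|\boldsymbol\xi\|$ the Euclidean norm. The problem is analyzed in frequency space: $\hat u_t(\boldsymbol\xi,t)=-z(\boldsymbol\xi)\hat u(\boldsymbol\xi,t)+\hat f(\boldsymbol\xi)$, $\hat u(\boldsymbol\xi,0)=0$, $\hat u(\boldsymbol\xi,t_0)=\hat y(\boldsymbol\xi)$, so that $\hat u(\boldsymbol\xi,t)=\frac{1-e^{-z(\boldsymbol\xi)t}}{z(\boldsymbol\xi)}\hat f(\boldsymbol\xi)$ and $\hat f=\Lambda\hat y$. The number $\delta_M>0$ is the maximum noise level.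
   Formalization: The formal theorem adds the hypothesis δ ≤ C (so that μ ≤ 1); without it the bound is false, e.g. n=1, α=ν=t₀=1, β=0, p=2, δ=1, C=1/100, f=y=0 and ŷ_δ a normalized indicator of |ξ| ≤ 1/μ gives error ≥ 0.79 against a bound of 0.5. *)

theory Defs
  imports "HOL-Analysis.Analysis"
begin

text \<open>
  Elements of \<open>L\<^sup>2\<close> are represented by Borel functions; every class modulo Lebesgue null sets
  has such a representative, so all statements about them are up to null sets.
\<close>

definition square_integrable :: "('a::euclidean_space \<Rightarrow> complex) \<Rightarrow> bool" where
  "square_integrable g \<longleftrightarrow>
     g \<in> borel_measurable lborel \<and> integrable lborel (\<lambda>x. (cmod (g x))\<^sup>2)"

definition L2_norm :: "('a::euclidean_space \<Rightarrow> complex) \<Rightarrow> real" where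
  "L2_norm g = sqrt (LINT x|lborel. (cmod (g x))\<^sup>2)"

definition truncated_fourier ::
    "real \<Rightarrow> ('a::euclidean_space \<Rightarrow> complex) \<Rightarrow> 'a \<Rightarrow> complex" where
  "truncated_fourier R g \<xi> =
     complex_of_real ((2 * pi) powr (- (real DIM('a) / 2))) *
     (LINT x:cball 0 R|lborel. exp (- (\<i> * complex_of_real (\<xi> \<bullet> x))) * g x)"

text \<open>
  For \<open>g\<close> in \<open>L\<^sup>2\<close> the Fourier integral need not converge absolutely, so it is understood as the
  \<open>L\<^sup>2\<close> limit of the integrals over balls. The distance is an extended nonnegative
  integral because the Bochner integral of a non-integrable function is 0.
\<close>

definition has_fourier_transform ::
    "('a::euclidean_space \<Rightarrow> complex) \<Rightarrow> ('a \<Rightarrow> complex) \<Rightarrow> bool" where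
  "has_fourier_transform g h \<longleftrightarrow>
     square_integrable g \<and> square_integrable h \<and>
     ((\<lambda>R. \<integral>\<^sup>+ \<xi>. ennreal ((cmod (h \<xi> - truncated_fourier R g \<xi>))\<^sup>2) \<partial>lborel) \<longlongrightarrow> 0) at_top"

text \<open>
  The limit exists for every \<open>g\<close> in \<open>L\<^sup>2\<close> by Plancherel's theorem and is unique up to null sets;
  the choice below only selects a representative.
\<close>

definition fourier_transform :: "('a::euclidean_space \<Rightarrow> complex) \<Rightarrow> 'a \<Rightarrow> complex" where
  "fourier_transform g = (SOME h. has_fourier_transform g h)"

definition in_sobolev_space :: "real \<Rightarrow> ('a::euclidean_space \<Rightarrow> complex) \<Rightarrow> bool" where
  "in_sobolev_space p f \<longleftrightarrow> square_integrable f \<and>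
     integrable lborel (\<lambda>\<xi>. (cmod (fourier_transform f \<xi>))\<^sup>2 * (1 + (norm \<xi>)\<^sup>2) powr p)"

text \<open>Meaningful only on \<^const>\<open>in_sobolev_space\<close>: elsewhere the integral is 0 by convention.\<close>

definition sobolev_norm :: "real \<Rightarrow> ('a::euclidean_space \<Rightarrow> complex) \<Rightarrow> real" where
  "sobolev_norm p f =
     sqrt (LINT \<xi>|lborel. (cmod (fourier_transform f \<xi>))\<^sup>2 * (1 + (norm \<xi>)\<^sup>2) powr p)"

text \<open>
  The Fourier transform turns \<open>\<alpha>\<^sup>2 \<Delta> u - \<beta> \<bullet> \<nabla>u - \<nu> u\<close> into multiplication by \<open>- symbol_z \<alpha> \<beta> \<nu>\<close>.
\<close>

definition symbol_z :: "real \<Rightarrow> 'a::euclidean_space \<Rightarrow> real \<Rightarrow> 'a \<Rightarrow> complex" where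
  "symbol_z \<alpha> \<beta> \<nu> \<xi> =
     complex_of_real (\<alpha>\<^sup>2 * (norm \<xi>)\<^sup>2) + \<i> * complex_of_real (\<beta> \<bullet> \<xi>) + complex_of_real \<nu>"

definition Lambda :: "real \<Rightarrow> 'a::euclidean_space \<Rightarrow> real \<Rightarrow> real \<Rightarrow> 'a \<Rightarrow> complex" where
  "Lambda \<alpha> \<beta> \<nu> t\<^sub>0 \<xi> =
     symbol_z \<alpha> \<beta> \<nu> \<xi> / (1 - exp (- (symbol_z \<alpha> \<beta> \<nu> \<xi> * complex_of_real t\<^sub>0)))"

text \<open>
  \<open>u\<close> solves \<open>u\<^sub>t = \<alpha>\<^sup>2 \<Delta> u - \<beta> \<bullet> \<nabla>u - \<nu> u + f\<close> for \<open>t > 0\<close>, with initial value 0 and value \<open>y\<close> at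
  time \<open>t\<^sub>0\<close>. The equation is read in frequency space, as an ordinary differential equation in
  \<open>t\<close> for almost every frequency. Since each \<open>u t\<close> determines its transform only up to a null
  set depending on \<open>t\<close>, a choice \<open>v\<close> of representatives regular in \<open>t\<close> is required to exist;
  continuity on \<open>{0..}\<close> connects the equation with the initial value.
\<close>

definition solves_source_problem ::
    "real \<Rightarrow> 'a::euclidean_space \<Rightarrow> real \<Rightarrow> real \<Rightarrow>
     (real \<Rightarrow> 'a \<Rightarrow> complex) \<Rightarrow> ('a \<Rightarrow> complex) \<Rightarrow> ('a \<Rightarrow> complex) \<Rightarrow> bool" where
  "solves_source_problem \<alpha> \<beta> \<nu> t\<^sub>0 u f y \<longleftrightarrow>
     (\<forall>t\<ge>0. square_integrable (u t)) \<and>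
     (AE x in lborel. u 0 x = 0) \<and>
     (AE x in lborel. u t\<^sub>0 x = y x) \<and>
     (\<exists>v. (\<forall>t\<ge>0. AE \<xi> in lborel. v t \<xi> = fourier_transform (u t) \<xi>) \<and>
          (AE \<xi> in lborel.
             continuous_on {0..} (\<lambda>t. v t \<xi>) \<and>
             (\<forall>t>0. ((\<lambda>s. v s \<xi>) has_vector_derivative
                       - symbol_z \<alpha> \<beta> \<nu> \<xi> * v t \<xi> + fourier_transform f \<xi>) (at t))))"

end

theory Submission
  imports Defs "HOL-Probability.Characteristic_Functions"
begin

text \<open>
  The whole estimate takes place on the frequency side. For almost every frequency \<open>\<xi>\<close> the source
  problem is a scalar linear differential equation in time; solving it with zero initial value
  gives \<open>fourier_transform f = \<Lambda> \<cdot> fourier_transform y\<close> (\<open>source_transform_eq_Lambda\<close>). With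
  \<open>w = 1 + \<mu>\<^sup>2\<parallel>\<xi>\<parallel>\<^sup>2\<close> and \<open>F, Y, Y\<^sub>\<delta>\<close> the transforms of \<open>f, y, y\<^sub>\<delta>\<close>, the error therefore splits into a bias and a noise
  part,
  \<open>F - \<Lambda>/w \<cdot> Y\<^sub>\<delta> = (\<mu>\<^sup>2\<parallel>\<xi>\<parallel>\<^sup>2/w) \<cdot> F + (\<Lambda>/w) \<cdot> (Y - Y\<^sub>\<delta>)\<close>.

  The bias factor is at most \<open>max (\<mu>\<^sup>p) \<mu>\<^sup>2 \<cdot> (1 + \<parallel>\<xi>\<parallel>\<^sup>2)\<^bsup>p/2\<^esup>\<close> (\<open>filter_bias_le\<close>), so the bias is
  controlled by the Sobolev norm of \<open>f\<close>. In the noise part \<open>\<Lambda>\<close> grows quadratically,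
  \<open>\<bar>\<Lambda>\<bar> \<le> 2M(1 + \<parallel>\<xi>\<parallel>\<^sup>2)\<close> (\<open>norm_Lambda_le\<close>), and dividing by \<open>w\<close> turns this into \<open>2M/\<mu>\<^sup>2\<close>, because
  \<open>\<mu> \<le> 1\<close>. The choice of \<open>\<mu>\<close> makes \<open>\<delta>/\<mu>\<^sup>2\<close> and \<open>C\<mu>\<^sup>p\<close> equal (\<open>parameter_choice\<close>).

  Going back to \<open>f - f\<^sub>\<delta>\<^sub>\<mu>\<close> requires that the transform, defined as an \<open>L\<^sup>2\<close> limit of integrals over
  balls, exists on all of \<open>L\<^sup>2\<close> (\<open>fourier_transform_exists\<close>), is compatible with differences
  (\<open>has_fourier_transform_diff\<close>) and is isometric (\<open>Plancherel\<close>). For an integrable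
  square-integrable \<open>g\<close>, the isometry comes from inserting the weight \<open>exp (-\<parallel>s\<xi>\<parallel>\<^sup>2/2)\<close>: by Fubini
  and the self-duality of the Gaussian, the weighted energy of the transform is a Gaussian average,
  over shifts \<open>sv\<close>, of \<open>\<parallel>g\<parallel>\<^sup>2\<close> minus half the squared \<open>L\<^sup>2\<close> distance between \<open>g\<close> and its shift
  (\<open>gaussian_weighted_energy\<close>). As \<open>s\<close> tends to 0 this distance vanishes by continuity of
  translations, while the weights increase to 1. Completeness of \<open>L\<^sup>2\<close> then extends the transform
  from functions cut off to balls to all of \<open>L\<^sup>2\<close>.
\<close>

section \<open>Square-integrable functions\<close>

lemma square_integrableD:
  assumes "square_integrable g"
  shows "g \<in> borel_measurable borel" "integrable lborel (\<lambda>x. (cmod (g x))\<^sup>2)"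
  using assms by (auto simp: square_integrable_def)

lemma L2_norm_nonneg [simp]: "0 \<le> L2_norm g"
  by (simp add: L2_norm_def)

lemma L2_norm_power2: "(L2_norm g)\<^sup>2 = (LINT x|lborel. (cmod (g x))\<^sup>2)"
  by (simp add: L2_norm_def)

lemma square_integrable_dominated:
  assumes b: "square_integrable b" and a: "a \<in> borel_measurable borel"
    and le: "AE x in lborel. cmod (a x) \<le> c * cmod (b x)" and c: "0 \<le> c"
  shows "square_integrable a" "L2_norm a \<le> c * L2_norm b"
proof -
  note b' = square_integrableD[OF b]
  have le2: "AE x in lborel. (cmod (a x))\<^sup>2 \<le> c\<^sup>2 * (cmod (b x))\<^sup>2"
    using le
  proof eventually_elim
    case (elim x)
    then have "(cmod (a x))\<^sup>2 \<le> (c * cmod (b x))\<^sup>2" by (intro power_mono) auto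
    then show ?case by (simp add: power_mult_distrib)
  qed
  have int: "integrable lborel (\<lambda>x. (cmod (a x))\<^sup>2)"
    by (rule Bochner_Integration.integrable_bound[of _ "\<lambda>x. c\<^sup>2 * (cmod (b x))\<^sup>2"])
       (use a b' le2 in auto)
  then show "square_integrable a" using a by (simp add: square_integrable_def)
  have "(LINT x|lborel. (cmod (a x))\<^sup>2) \<le> (LINT x|lborel. c\<^sup>2 * (cmod (b x))\<^sup>2)"
    by (rule integral_mono_AE) (use int b' le2 in auto)
  then have "(L2_norm a)\<^sup>2 \<le> (c * L2_norm b)\<^sup>2"
    by (simp add: L2_norm_power2 power_mult_distrib)
  then show "L2_norm a \<le> c * L2_norm b"
    by (rule power2_le_imp_le) (simp add: c)
qed

lemma square_integrable_mult_bounded: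
  assumes g: "square_integrable g" and w: "w \<in> borel_measurable borel" and le: "\<And>x. cmod (w x) \<le> 1"
  shows "square_integrable (\<lambda>x. w x * g x)"
proof -
  have [measurable]: "g \<in> borel_measurable borel" using square_integrableD[OF g] by auto
  note w[measurable]
  have *: "AE x in lborel. cmod (w x * g x) \<le> 1 * cmod (g x)"
    using le by (auto simp: norm_mult intro!: mult_left_le_one_le)
  show "square_integrable (\<lambda>x. w x * g x)"
    using square_integrable_dominated[OF g _ *] by auto
qed

lemma square_integrable_zero [simp]: "square_integrable (\<lambda>x. 0)"
  by (simp add: square_integrable_def)

lemma square_integrable_cmult:
  assumes "square_integrable g"
  shows "square_integrable (\<lambda>x. c * g x)"
  using assms by (auto simp: square_integrable_def norm_mult power_mult_distrib)

lemma square_integrable_add: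
  assumes a: "square_integrable a" and b: "square_integrable b"
  shows "square_integrable (\<lambda>x. a x + b x)"
proof -
  note [measurable] = square_integrableD(1)[OF a] square_integrableD(1)[OF b]
  have le: "(cmod (z + w))\<^sup>2 \<le> 2 * (cmod z)\<^sup>2 + 2 * (cmod w)\<^sup>2" for z w
  proof -
    have "(cmod (z + w))\<^sup>2 \<le> (cmod z + cmod w)\<^sup>2" by (simp add: norm_triangle_ineq power_mono)
    also have "\<dots> \<le> 2 * (cmod z)\<^sup>2 + 2 * (cmod w)\<^sup>2"
      using sum_squares_bound[of "cmod z" "cmod w"] by (simp add: power2_sum)
    finally show ?thesis .
  qed
  have "integrable lborel (\<lambda>x. (cmod (a x + b x))\<^sup>2)"
    by (rule Bochner_Integration.integrable_bound[of _ "\<lambda>x. 2 * (cmod (a x))\<^sup>2 + 2 * (cmod (b x))\<^sup>2"])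
       (use le square_integrableD(2)[OF a] square_integrableD(2)[OF b] in auto)
  then show ?thesis by (simp add: square_integrable_def)
qed

lemma square_integrable_diff:
  assumes "square_integrable a" "square_integrable b"
  shows "square_integrable (\<lambda>x. a x - b x)"
  using square_integrable_add[OF assms(1) square_integrable_cmult[OF assms(2), of "-1"]] by simp

lemma integrable_mult_of_square_integrable:
  assumes a: "square_integrable a" and b: "square_integrable b"
  shows "integrable lborel (\<lambda>x. a x * b x)"
    and "(LINT x|lborel. cmod (a x) * cmod (b x)) \<le> ((L2_norm a)\<^sup>2 + (L2_norm b)\<^sup>2) / 2"
proof -
  note [measurable] = square_integrableD(1)[OF a] square_integrableD(1)[OF b]
  note ia = square_integrableD(2)[OF a] and ib = square_integrableD(2)[OF b]
  have le: "cmod z * cmod w \<le> ((cmod z)\<^sup>2 + (cmod w)\<^sup>2) / 2" for z w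
    using sum_squares_bound[of "cmod z" "cmod w"] by simp
  have i: "integrable lborel (\<lambda>x. ((cmod (a x))\<^sup>2 + (cmod (b x))\<^sup>2) / 2)"
    using ia ib by auto
  show i2: "integrable lborel (\<lambda>x. a x * b x)"
    by (rule Bochner_Integration.integrable_bound[OF i]) (use le in \<open>auto simp: norm_mult\<close>)
  have "(LINT x|lborel. cmod (a x) * cmod (b x)) \<le> (LINT x|lborel. ((cmod (a x))\<^sup>2 + (cmod (b x))\<^sup>2) / 2)"
    by (rule integral_mono) (use integrable_norm[OF i2] i le in \<open>auto simp: norm_mult\<close>)
  then show "(LINT x|lborel. cmod (a x) * cmod (b x)) \<le> ((L2_norm a)\<^sup>2 + (L2_norm b)\<^sup>2) / 2"
    using ia ib by (simp add: L2_norm_power2)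
qed

lemma L2_norm_triangle:
  assumes a: "square_integrable a" and b: "square_integrable b"
  shows "L2_norm (\<lambda>x. a x + b x) \<le> L2_norm a + L2_norm b"
proof -
  note [measurable] = square_integrableD(1)[OF a] square_integrableD(1)[OF b]
  note ia = square_integrableD(2)[OF a] and ib = square_integrableD(2)[OF b]
  have iab: "integrable lborel (\<lambda>x. cmod (a x) * cmod (b x))"
    using integrable_norm[OF integrable_mult_of_square_integrable(1)[OF a b]] by (simp add: norm_mult)
  have "(\<integral>\<^sup>+x. ennreal (cmod (a x)) * ennreal (cmod (b x)) \<partial>lborel)\<^sup>2
      \<le> (\<integral>\<^sup>+x. (ennreal (cmod (a x)))\<^sup>2 \<partial>lborel) * (\<integral>\<^sup>+x. (ennreal (cmod (b x)))\<^sup>2 \<partial>lborel)"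
    by (rule Cauchy_Schwarz_nn_integral) auto
  then have "ennreal ((LINT x|lborel. cmod (a x) * cmod (b x))\<^sup>2)
      \<le> ennreal ((L2_norm a)\<^sup>2 * (L2_norm b)\<^sup>2)"
    using ia ib iab
    by (simp add: ennreal_mult[symmetric] ennreal_power nn_integral_eq_integral L2_norm_power2)
  then have "(LINT x|lborel. cmod (a x) * cmod (b x))\<^sup>2 \<le> (L2_norm a * L2_norm b)\<^sup>2"
    by (simp add: power_mult_distrib)
  then have cs: "(LINT x|lborel. cmod (a x) * cmod (b x)) \<le> L2_norm a * L2_norm b"
    by (rule power2_le_imp_le) simp
  have "(L2_norm (\<lambda>x. a x + b x))\<^sup>2
      \<le> (LINT x|lborel. (cmod (a x))\<^sup>2 + (cmod (b x))\<^sup>2 + 2 * (cmod (a x) * cmod (b x)))"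
    unfolding L2_norm_power2
  proof (rule integral_mono)
    show "integrable lborel (\<lambda>x. (cmod (a x + b x))\<^sup>2)"
      using square_integrableD(2)[OF square_integrable_add[OF a b]] .
    show "integrable lborel (\<lambda>x. (cmod (a x))\<^sup>2 + (cmod (b x))\<^sup>2 + 2 * (cmod (a x) * cmod (b x)))"
      using ia ib iab by auto
    show "(cmod (a x + b x))\<^sup>2 \<le> (cmod (a x))\<^sup>2 + (cmod (b x))\<^sup>2 + 2 * (cmod (a x) * cmod (b x))" for x
      using power_mono[OF norm_triangle_ineq[of "a x" "b x"], of 2] by (simp add: power2_sum)
  qed
  also have "\<dots> = (L2_norm a)\<^sup>2 + (L2_norm b)\<^sup>2 + 2 * (LINT x|lborel. cmod (a x) * cmod (b x))"
    using ia ib iab by (simp add: L2_norm_power2)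
  also have "\<dots> \<le> (L2_norm a + L2_norm b)\<^sup>2"
    using cs by (simp add: power2_sum)
  finally show ?thesis by (rule power2_le_imp_le) simp
qed

lemma L2_norm_eq_zero_imp_AE:
  assumes "square_integrable g" "L2_norm g = 0"
  shows "AE x in lborel. g x = 0"
proof -
  have "(LINT x|lborel. (cmod (g x))\<^sup>2) = 0" using L2_norm_power2[of g] assms(2) by simp
  then have "AE x in lborel. (cmod (g x))\<^sup>2 = 0"
    using integral_nonneg_eq_0_iff_AE[OF square_integrableD(2)[OF assms(1)]] by auto
  then show ?thesis by simp
qed

lemma L2_norm_cong_AE:
  assumes "g \<in> borel_measurable borel" "h \<in> borel_measurable borel" "AE x in lborel. g x = h x"
  shows "L2_norm g = L2_norm h"
  unfolding L2_norm_def using assms by (auto intro!: integral_cong_AE)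

lemma nn_integral_cmod_power2:
  assumes "square_integrable g"
  shows "(\<integral>\<^sup>+x. ennreal ((cmod (g x))\<^sup>2) \<partial>lborel) = ennreal ((L2_norm g)\<^sup>2)"
  using square_integrableD(2)[OF assms] by (simp add: nn_integral_eq_integral L2_norm_power2)

section \<open>Change of variables and Fubini\<close>

lemma lborel_affine_substitution:
  fixes f :: "'a::euclidean_space \<Rightarrow> 'b::{banach, second_countable_topology}"
  assumes f: "integrable lborel f" and c: "c \<noteq> 0"
  shows "integrable lborel (\<lambda>x. f (t + c *\<^sub>R x))"
    and "(LINT x|lborel. f x) = \<bar>c\<bar> ^ DIM('a) *\<^sub>R (LINT x|lborel. f (t + c *\<^sub>R x))"
proof -
  have [measurable]: "f \<in> borel_measurable borel" using borel_measurable_integrable[OF f] by simp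
  let ?D = "density (distr lborel borel (\<lambda>x. t + c *\<^sub>R x)) (\<lambda>_. ennreal (\<bar>c\<bar> ^ DIM('a)))"
  have eq: "lborel = ?D"
    using lborel_affine[OF c, of t] by simp
  have "integrable ?D f" using f by (simp flip: eq)
  then show "integrable lborel (\<lambda>x. f (t + c *\<^sub>R x))"
    using c integrable_scaleR_right[of "inverse (\<bar>c\<bar> ^ DIM('a))" lborel "\<lambda>x. \<bar>c\<bar> ^ DIM('a) *\<^sub>R f (t + c *\<^sub>R x)"]
    by (simp add: integrable_density integrable_distr_eq)
  have "(LINT x|lborel. f x) = (LINT x|?D. f x)" by (simp flip: eq)
  also have "\<dots> = \<bar>c\<bar> ^ DIM('a) *\<^sub>R (LINT x|lborel. f (t + c *\<^sub>R x))"
    by (simp add: integral_density integral_distr)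
  finally show "(LINT x|lborel. f x) = \<bar>c\<bar> ^ DIM('a) *\<^sub>R (LINT x|lborel. f (t + c *\<^sub>R x))" .
qed

lemma lborel_translation:
  fixes f :: "'a::euclidean_space \<Rightarrow> 'b::{banach, second_countable_topology}"
  assumes f: "integrable lborel f"
  shows "integrable lborel (\<lambda>x. f (x + w))" "(LINT x|lborel. f (x + w)) = (LINT x|lborel. f x)"
  using lborel_affine_substitution[OF f, of 1 w] by (simp_all add: add.commute)

text \<open>
  Joint integrability is automatic because the kernel is dominated by the product of two
  integrable functions. With \<open>k x y = exp (\<plusminus>\<i> (x \<bullet> y))\<close> this moves a Fourier integral from one
  factor to the other.
\<close>
lemma Fubini_bounded_kernel:
  fixes a :: "'a::euclidean_space \<Rightarrow> complex" and b :: "'b::euclidean_space \<Rightarrow> complex"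
  assumes a: "integrable lborel a" and b: "integrable lborel b"
    and k[measurable]: "case_prod k \<in> borel_measurable (borel \<Otimes>\<^sub>M borel)" and le: "\<And>x y. cmod (k x y) \<le> 1"
  shows "(LINT x|lborel. a x * (LINT y|lborel. k x y * b y))
       = (LINT y|lborel. b y * (LINT x|lborel. k x y * a x))"
proof -
  have [measurable]: "a \<in> borel_measurable borel" "b \<in> borel_measurable borel"
    using borel_measurable_integrable[OF a] borel_measurable_integrable[OF b] by auto
  have ky: "integrable lborel (\<lambda>y. k x y * b y)" for x
    by (rule Bochner_Integration.integrable_bound[OF b])
       (auto simp: norm_mult intro!: mult_left_le_one_le le)
  have int: "integrable (lborel \<Otimes>\<^sub>M lborel) (\<lambda>(x, y). k x y * a x * b y)"
  proof (rule Bochner_Integration.integrable_bound)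
    show "integrable (lborel \<Otimes>\<^sub>M lborel) (\<lambda>(x, y). a x * b y)"
    proof (rule lborel_pair.Fubini_integrable)
      show "integrable lborel (\<lambda>x. LINT y|lborel. norm (case (x, y) of (x, y) \<Rightarrow> a x * b y))"
        using a b by (simp add: norm_mult)
    qed (use b in auto)
    show "AE z in lborel \<Otimes>\<^sub>M lborel.
      norm (case z of (x, y) \<Rightarrow> k x y * a x * b y) \<le> norm (case z of (x, y) \<Rightarrow> a x * b y)"
      by (rule AE_I2) (auto split: prod.split simp: norm_mult mult.assoc intro!: mult_left_le_one_le le)
  qed auto
  have "(LINT x|lborel. a x * (LINT y|lborel. k x y * b y))
      = (LINT x|lborel. LINT y|lborel. k x y * a x * b y)"
    by (simp add: mult_ac flip: integral_mult_right_zero)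
  also have "\<dots> = (LINT y|lborel. LINT x|lborel. k x y * a x * b y)"
    using lborel_pair.Fubini_integral[OF int] by simp
  also have "\<dots> = (LINT y|lborel. b y * (LINT x|lborel. k x y * a x))"
    by (simp add: mult_ac flip: integral_mult_right_zero)
  finally show ?thesis .
qed

section \<open>The Gaussian and its Fourier transform\<close>

definition gaussian :: "'a::euclidean_space \<Rightarrow> real" where
  "gaussian x = exp (- (norm x)\<^sup>2 / 2)"

lemma gaussian_pos [simp]: "0 < gaussian x" "0 \<le> gaussian x"
  by (auto simp: gaussian_def)

lemma gaussian_le_one [simp]: "gaussian x \<le> 1"
  by (simp add: gaussian_def)

lemma borel_measurable_gaussian [measurable]: "gaussian \<in> borel_measurable borel"
  unfolding gaussian_def by measurable

text \<open>
  Lebesgue measure is the image of the product of one-dimensional Lebesgue measures under the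
  coordinate isomorphism, so integrals of products of functions of one coordinate factor.
\<close>
lemma lborel_integral_prod:
  fixes f :: "'a::euclidean_space \<Rightarrow> real \<Rightarrow> complex"
  assumes f: "\<And>b. b \<in> Basis \<Longrightarrow> integrable lborel (f b)"
  shows "integrable lborel (\<lambda>x::'a. \<Prod>b\<in>Basis. f b (x \<bullet> b))"
    and "(LINT x::'a|lborel. (\<Prod>b\<in>Basis. f b (x \<bullet> b))) = (\<Prod>b\<in>Basis. LINT t|lborel. f b t)"
proof -
  have [measurable]: "f b \<in> borel_measurable borel" if "b \<in> Basis" for b
    using borel_measurable_integrable[OF f[OF that]] by simp
  interpret product_sigma_finite "\<lambda>_::'a. lborel :: real measure" ..
  let ?T = "\<lambda>h::'a \<Rightarrow> real. \<Sum>b\<in>Basis. h b *\<^sub>R b"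
  have coord: "?T h \<bullet> b = h b" if "b \<in> Basis" for h b
    using that by (simp add: inner_sum_left inner_Basis if_distrib sum.delta cong: if_cong)
  have eq: "(\<lambda>h. \<Prod>b\<in>Basis. f b (?T h \<bullet> b)) = (\<lambda>h. \<Prod>b\<in>Basis. f b (h b))"
    by (intro ext prod.cong refl) (simp add: coord)
  show "integrable lborel (\<lambda>x::'a. \<Prod>b\<in>Basis. f b (x \<bullet> b))"
    by (subst lborel_eq, subst integrable_distr_eq)
       (use f in \<open>simp_all add: eq product_integrable_prod\<close>)
  show "(LINT x::'a|lborel. (\<Prod>b\<in>Basis. f b (x \<bullet> b))) = (\<Prod>b\<in>Basis. LINT t|lborel. f b t)"
    by (subst lborel_eq, subst integral_distr)
       (use f in \<open>simp_all add: eq product_integral_prod\<close>)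
qed

text \<open>
  This is the characteristic function of the standard normal distribution without its normalizing
  factor.
\<close>
lemma gaussian_fourier_real:
  fixes t :: real
  shows "integrable lborel (\<lambda>v. iexp (t * v) * complex_of_real (exp (- v\<^sup>2 / 2)))"
    and "(LINT v|lborel. iexp (t * v) * complex_of_real (exp (- v\<^sup>2 / 2)))
       = complex_of_real (sqrt (2 * pi) * exp (- t\<^sup>2 / 2))"
proof -
  have dens: "exp (- v\<^sup>2 / 2) = sqrt (2 * pi) * std_normal_density v" for v :: real
    by (simp add: std_normal_density_def)
  have "integrable lborel (\<lambda>v. sqrt (2 * pi) * (std_normal_density v * v ^ 0))"
    by (rule integrable_mult_right) (rule integrable_std_normal_moment)
  then have "integrable lborel (\<lambda>v::real. exp (- v\<^sup>2 / 2))" unfolding dens by simp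
  then show "integrable lborel (\<lambda>v. iexp (t * v) * complex_of_real (exp (- v\<^sup>2 / 2)))"
    by (rule Bochner_Integration.integrable_bound) (auto simp: norm_mult)
  have "(LINT v|lborel. std_normal_density v *\<^sub>R iexp (t * v)) = char std_normal_distribution t"
    unfolding char_def by (subst integral_density) auto
  also have "\<dots> = complex_of_real (exp (- t\<^sup>2 / 2))"
    by (simp add: char_std_normal_distribution)
  finally have *: "(LINT v|lborel. std_normal_density v *\<^sub>R iexp (t * v)) = complex_of_real (exp (- t\<^sup>2 / 2))" .
  have "(LINT v|lborel. iexp (t * v) * complex_of_real (exp (- v\<^sup>2 / 2)))
      = (LINT v|lborel. complex_of_real (sqrt (2 * pi)) * (std_normal_density v *\<^sub>R iexp (t * v)))"
    by (intro Bochner_Integration.integral_cong refl) (simp only: dens, simp add: scaleR_conv_of_real)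
  also have "\<dots> = complex_of_real (sqrt (2 * pi) * exp (- t\<^sup>2 / 2))"
    by (subst integral_mult_right_zero, subst *) simp
  finally show "(LINT v|lborel. iexp (t * v) * complex_of_real (exp (- v\<^sup>2 / 2)))
       = complex_of_real (sqrt (2 * pi) * exp (- t\<^sup>2 / 2))" .
qed

lemma norm_power2_eq_sum_Basis: "(norm (x::'a::euclidean_space))\<^sup>2 = (\<Sum>b\<in>Basis. (x \<bullet> b)\<^sup>2)"
  by (subst power2_norm_eq_inner, subst euclidean_inner) (simp add: power2_eq_square)

lemma gaussian_eq_prod: "gaussian (x::'a::euclidean_space) = (\<Prod>b\<in>Basis. exp (- (x \<bullet> b)\<^sup>2 / 2))"
  by (simp add: gaussian_def norm_power2_eq_sum_Basis exp_sum sum_negf flip: sum_divide_distrib exp_sum)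

lemma gaussian_fourier:
  fixes w :: "'a::euclidean_space"
  shows "integrable lborel (\<lambda>v. iexp (w \<bullet> v) * complex_of_real (gaussian v))"
    and "(LINT v|lborel. iexp (w \<bullet> v) * complex_of_real (gaussian v))
       = complex_of_real (sqrt (2 * pi) ^ DIM('a) * gaussian w)"
proof -
  let ?f = "\<lambda>b t. iexp ((w \<bullet> b) * t) * complex_of_real (exp (- t\<^sup>2 / 2))"
  have eq: "iexp (w \<bullet> v) * complex_of_real (gaussian v) = (\<Prod>b\<in>Basis. ?f b (v \<bullet> b))" for v
    unfolding prod.distrib gaussian_eq_prod of_real_prod
    by (subst euclidean_inner) (simp add: exp_sum sum_distrib_left)
  show "integrable lborel (\<lambda>v. iexp (w \<bullet> v) * complex_of_real (gaussian v))"
    unfolding eq by (rule lborel_integral_prod(1)) (rule gaussian_fourier_real)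
  show "(LINT v|lborel. iexp (w \<bullet> v) * complex_of_real (gaussian v))
       = complex_of_real (sqrt (2 * pi) ^ DIM('a) * gaussian w)"
    unfolding eq
    by (subst lborel_integral_prod(2), rule gaussian_fourier_real,
        subst gaussian_fourier_real(2))
       (simp add: prod.distrib gaussian_eq_prod prod_constant)
qed

lemma integrable_gaussian: "integrable lborel (gaussian :: 'a::euclidean_space \<Rightarrow> real)"
  using integrable_norm[OF gaussian_fourier(1)[of "0::'a"]] by simp

lemma integral_gaussian:
  "(LINT v::'a::euclidean_space|lborel. gaussian v) = sqrt (2 * pi) ^ DIM('a)"
proof -
  have "complex_of_real (LINT v::'a|lborel. gaussian v) = complex_of_real (sqrt (2 * pi) ^ DIM('a))"
    using gaussian_fourier(2)[of "0::'a"] by (simp add: gaussian_def[of 0])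
  then show ?thesis by (simp only: of_real_eq_iff)
qed

section \<open>Continuity of translations\<close>

text \<open>
  Translation is an isometry of \<open>L\<^sup>1\<close>, so the property passes to limits in \<open>L\<^sup>1\<close>: the distance
  between \<open>f\<close> and its shift exceeds that for \<open>h\<close> by at most twice the distance from \<open>f\<close> to \<open>h\<close>.
\<close>
lemma L1_translation_continuous_of_dense:
  fixes f :: "'a::euclidean_space \<Rightarrow> 'b::{banach, second_countable_topology}"
  assumes f: "integrable lborel f"
    and approx: "\<And>e. 0 < e \<Longrightarrow> \<exists>h. integrable lborel h \<and> (LINT x|lborel. norm (f x - h x)) \<le> e \<and>
      (\<lambda>k. LINT x|lborel. norm (h (x + w k) - h x)) \<longlonglongrightarrow> 0"
  shows "(\<lambda>k. LINT x|lborel. norm (f (x + w k) - f x)) \<longlonglongrightarrow> 0"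
proof (rule LIMSEQ_I)
  fix r :: real assume "0 < r"
  then obtain h where h: "integrable lborel h" and close: "(LINT x|lborel. norm (f x - h x)) \<le> r / 4"
    and lim: "(\<lambda>k. LINT x|lborel. norm (h (x + w k) - h x)) \<longlonglongrightarrow> 0"
    using approx[of "r / 4"] by auto
  from LIMSEQ_D[OF lim, of "r / 2"] \<open>0 < r\<close>
  obtain N where N: "\<And>k. N \<le> k \<Longrightarrow> (LINT x|lborel. norm (h (x + w k) - h x)) < r / 2"
    by fastforce
  have "norm ((LINT x|lborel. norm (f (x + w k) - f x)) - 0) < r" if "N \<le> k" for k
  proof -
    note ft = lborel_translation[OF f, of "w k"] and ht = lborel_translation[OF h, of "w k"]
    note fh = integrable_norm[OF Bochner_Integration.integrable_diff[OF f h]]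
    note fht = lborel_translation[OF fh, of "w k"]
    note hh = integrable_norm[OF Bochner_Integration.integrable_diff[OF ht(1) h]]
    have "(LINT x|lborel. norm (f (x + w k) - f x))
        \<le> (LINT x|lborel. norm (f (x + w k) - h (x + w k)) + norm (h (x + w k) - h x) + norm (f x - h x))"
    proof (rule integral_mono)
      show "integrable lborel (\<lambda>x. norm (f (x + w k) - f x))" using ft f by auto
      show "integrable lborel (\<lambda>x. norm (f (x + w k) - h (x + w k)) + norm (h (x + w k) - h x) + norm (f x - h x))"
        using fht(1) hh fh by auto
      show "norm (f (x + w k) - f x)
          \<le> norm (f (x + w k) - h (x + w k)) + norm (h (x + w k) - h x) + norm (f x - h x)" for x
        by norm
    qed
    also have "\<dots> = (LINT x|lborel. norm (f x - h x)) + (LINT x|lborel. norm (h (x + w k) - h x))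
        + (LINT x|lborel. norm (f x - h x))"
      using fht hh fh by simp
    also have "\<dots> < r" using close N[OF that] by simp
    finally show ?thesis by simp
  qed
  then show "\<exists>N. \<forall>k\<ge>N. norm ((LINT x|lborel. norm (f (x + w k) - f x)) - 0) < r" by blast
qed

text \<open>
  For open \<open>U\<close> a point of \<open>U\<close> eventually stays in \<open>U\<close> when shifted, so by dominated convergence the
  measure of the set of points that leave \<open>U\<close> tends to 0. As many points enter as leave, since a
  shift preserves the measure of \<open>U\<close>, and the full difference is twice that measure.
\<close>
lemma L1_translation_continuous_open:
  fixes U :: "'a::euclidean_space set" and c :: "'b::{banach, second_countable_topology}"
  assumes U: "open U" "emeasure lborel U < \<infinity>" and w: "w \<longlonglongrightarrow> 0"
  shows "(\<lambda>k. LINT x|lborel. norm (indicator U (x + w k) *\<^sub>R c - indicator U x *\<^sub>R c)) \<longlonglongrightarrow> 0"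
proof -
  have [measurable]: "U \<in> sets borel" using U by simp
  have iU: "integrable lborel (indicator U :: 'a \<Rightarrow> real)" using U by simp
  let ?l = "\<lambda>k x. indicator U x * (1 - indicator U (x + w k)) :: real"
  have il: "integrable lborel (?l k)" for k
    by (rule Bochner_Integration.integrable_bound[OF iU]) (auto split: split_indicator)
  have "(\<lambda>k. LINT x|lborel. ?l k x) \<longlonglongrightarrow> (LINT x::'a|lborel. 0)"
  proof (rule integral_dominated_convergence[where w="indicator U"])
    show "AE x in lborel. (\<lambda>k. ?l k x) \<longlonglongrightarrow> 0"
    proof (rule AE_I2)
      fix x
      show "(\<lambda>k. ?l k x) \<longlonglongrightarrow> 0"
      proof (cases "x \<in> U")
        case True
        have "(\<lambda>k. x + w k) \<longlonglongrightarrow> x" using tendsto_add[OF tendsto_const w, of x] by simp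
        then have "\<forall>\<^sub>F k in sequentially. x + w k \<in> U" using U True by (auto dest: topological_tendstoD)
        then show ?thesis by (intro tendsto_eventually) (use True in \<open>auto elim!: eventually_mono\<close>)
      qed simp
    qed
    show "AE x in lborel. norm (?l k x) \<le> indicator U x" for k
      by (auto split: split_indicator)
  qed (use iU in auto)
  then have lim: "(\<lambda>k. norm c * (2 * (LINT x|lborel. ?l k x))) \<longlonglongrightarrow> norm c * (2 * 0)"
    by (intro tendsto_intros) simp
  have "(LINT x|lborel. norm (indicator U (x + w k) *\<^sub>R c - indicator U x *\<^sub>R c))
      = norm c * (2 * (LINT x|lborel. ?l k x))" for k
  proof -
    note t = lborel_translation[OF iU, of "w k"]
    \<comment> \<open>Here \<open>?l k\<close> is the indicator of the points that leave \<open>U\<close>; the last bracket integrates to 0.\<close>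
    have "norm (indicator U (x + w k) *\<^sub>R c - indicator U x *\<^sub>R c)
        = norm c * (2 * ?l k x + (indicator U (x + w k) - indicator U x))" for x
      by (auto split: split_indicator)
    then have "(LINT x|lborel. norm (indicator U (x + w k) *\<^sub>R c - indicator U x *\<^sub>R c))
        = norm c * (LINT x|lborel. 2 * ?l k x + (indicator U (x + w k) - indicator U x))"
      by (simp only: integral_mult_right_zero)
    also have "(LINT x|lborel. 2 * ?l k x + (indicator U (x + w k) - indicator U x))
        = (LINT x|lborel. 2 * ?l k x) + (LINT x|lborel. indicator U (x + w k) - indicator U x)"
      by (rule Bochner_Integration.integral_add) (use il t iU in auto)
    also have "(LINT x|lborel. indicator U (x + w k) - indicator U x) = (0::real)"
      by (subst Bochner_Integration.integral_diff) (use t iU in auto)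
    finally show ?thesis by (simp only: integral_mult_right_zero add_0_right)
  qed
  with lim show ?thesis by simp
qed

text \<open>
  Outer regularity reduces indicators of measurable sets to those of open sets; sums and limits then
  reach every integrable function.
\<close>
lemma L1_translation_continuous:
  fixes f :: "'a::euclidean_space \<Rightarrow> 'b::{banach, second_countable_topology}"
  assumes f: "integrable lborel f" and w: "w \<longlonglongrightarrow> 0"
  shows "(\<lambda>k. LINT x|lborel. norm (f (x + w k) - f x)) \<longlonglongrightarrow> 0"
  using f
proof (induction f rule: integrable_induct)
  case (base A c)
  then have A[measurable]: "A \<in> sets borel" by simp
  have iA: "integrable lborel (indicator A :: 'a \<Rightarrow> real)" using base by simp
  show ?case
  proof (rule L1_translation_continuous_of_dense)
    show "integrable lborel (\<lambda>x. indicator A x *\<^sub>R c)" using iA by (rule integrable_scaleR_left)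
    fix e :: real assume e: "0 < e"
    \<comment> \<open>The 1 avoids a division by \<open>norm c = 0\<close>.\<close>
    define d where "d = e / (1 + norm c)"
    have d: "0 < d" using e by (simp add: d_def add_pos_nonneg)
    obtain U where U: "open U" "A \<subseteq> U" and UA: "emeasure lborel (U - A) \<le> d"
      using outer_regular_lborel_le[OF A d] by blast
    have [measurable]: "U \<in> sets borel" using U by simp
    have "U = (U - A) \<union> A" using U by blast
    then have "emeasure lborel U \<le> emeasure lborel (U - A) + emeasure lborel A"
      using emeasure_subadditive[of "U - A" lborel A] by simp
    also have "\<dots> < \<infinity>" using base UA
      by (metis ennreal_add_less_top ennreal_less_top infinity_ennreal_def order_le_less_trans)
    finally have Ufin: "emeasure lborel U < \<infinity>" .
    then have iU: "integrable lborel (\<lambda>x. indicator U x *\<^sub>R c)" by simp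
    have "norm (indicator A x *\<^sub>R c - indicator U x *\<^sub>R c) = norm c * indicator (U - A) x" for x
      using U by (auto split: split_indicator)
    then have "(LINT x|lborel. norm (indicator A x *\<^sub>R c - indicator U x *\<^sub>R c)) = norm c * measure lborel (U - A)"
      by simp
    also have "\<dots> \<le> norm c * d"
      using UA d by (intro mult_left_mono) (auto simp: measure_def intro: enn2real_leI)
    also have "\<dots> \<le> e"
      using e by (simp add: d_def divide_simps add_pos_nonneg mult_ac)
    finally show "\<exists>h. integrable lborel h \<and> (LINT x|lborel. norm (indicator A x *\<^sub>R c - h x)) \<le> e \<and>
      (\<lambda>k. LINT x|lborel. norm (h (x + w k) - h x)) \<longlonglongrightarrow> 0"
      using iU L1_translation_continuous_open[OF U(1) Ufin w] by blast
  qed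
next
  case (add f g)
  show ?case
  proof (rule tendsto_sandwich[OF _ _ tendsto_const])
    show "(\<lambda>k. (LINT x|lborel. norm (f (x + w k) - f x)) + (LINT x|lborel. norm (g (x + w k) - g x))) \<longlonglongrightarrow> 0"
      using tendsto_add[OF add.IH] by simp
    have "(LINT x|lborel. norm (f (x + w k) + g (x + w k) - (f x + g x)))
      \<le> (LINT x|lborel. norm (f (x + w k) - f x)) + (LINT x|lborel. norm (g (x + w k) - g x))" for k
    proof -
      note t = lborel_translation(1)[OF add.hyps(1), of "w k"] lborel_translation(1)[OF add.hyps(2), of "w k"]
      have "(LINT x|lborel. norm (f (x + w k) + g (x + w k) - (f x + g x)))
        \<le> (LINT x|lborel. norm (f (x + w k) - f x) + norm (g (x + w k) - g x))"
        by (rule integral_mono) (use t add.hyps in \<open>auto simp: add_diff_add norm_triangle_ineq\<close>)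
      also have "\<dots> = (LINT x|lborel. norm (f (x + w k) - f x)) + (LINT x|lborel. norm (g (x + w k) - g x))"
        using t add.hyps by simp
      finally show ?thesis .
    qed
    then show "\<forall>\<^sub>F k in sequentially. (LINT x|lborel. norm (f (x + w k) + g (x + w k) - (f x + g x)))
      \<le> (LINT x|lborel. norm (f (x + w k) - f x)) + (LINT x|lborel. norm (g (x + w k) - g x))"
      by simp
  qed simp
next
  case (lim f s)
  show ?case
  proof (rule L1_translation_continuous_of_dense)
    fix e :: real assume e: "0 < e"
    have "(\<lambda>i. LINT x|lborel. norm (f x - s i x)) \<longlonglongrightarrow> (LINT x::'a|lborel. 0)"
    proof (rule integral_dominated_convergence[where w="\<lambda>x. 3 * norm (f x)"])
      show "AE x in lborel. (\<lambda>i. norm (f x - s i x)) \<longlonglongrightarrow> 0"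
      proof (rule AE_I2)
        fix x :: 'a
        have "(\<lambda>i. s i x) \<longlonglongrightarrow> f x" using lim.hyps(2) by simp
        from tendsto_norm[OF tendsto_diff[OF tendsto_const this, of "f x"]]
        show "(\<lambda>i. norm (f x - s i x)) \<longlonglongrightarrow> 0" by simp
      qed
      show "AE x in lborel. norm (norm (f x - s i x)) \<le> 3 * norm (f x)" for i
      proof (rule AE_I2)
        fix x :: 'a
        show "norm (norm (f x - s i x)) \<le> 3 * norm (f x)"
          using lim.hyps(3)[of x i] norm_triangle_ineq4[of "f x" "s i x"] by simp
      qed
    qed (use lim.hyps in auto)
    then obtain i where "\<bar>LINT x|lborel. norm (f x - s i x)\<bar> < e"
      using e by (auto dest!: LIMSEQ_D)
    then show "\<exists>h. integrable lborel h \<and> (LINT x|lborel. norm (f x - h x)) \<le> e \<and>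
      (\<lambda>k. LINT x|lborel. norm (h (x + w k) - h x)) \<longlonglongrightarrow> 0"
      using lim.hyps(1) lim.IH by (intro exI[of _ "s i"]) auto
  qed (rule lim.hyps)
qed

text \<open>
  The map \<open>a \<mapsto> \<parallel>a\<parallel> a\<close> is monotone enough: pairing the difference of its values with \<open>a - b\<close> gives
  \<open>(\<parallel>a\<parallel> + \<parallel>b\<parallel>) \<parallel>a - b\<parallel>\<^sup>2 / 2\<close> plus a nonnegative term, and \<open>\<parallel>a\<parallel> + \<parallel>b\<parallel> \<ge> \<parallel>a - b\<parallel>\<close>. The inequality
  transfers continuity of translations from \<open>L\<^sup>1\<close> to \<open>L\<^sup>2\<close> without any approximation in \<open>L\<^sup>2\<close>.
\<close>
lemma power2_dist_le_dist_signed_square: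
  fixes a b :: "'a::real_inner"
  shows "(norm (a - b))\<^sup>2 \<le> 2 * norm (norm a *\<^sub>R a - norm b *\<^sub>R b)"
proof (cases "a = b")
  case False
  let ?A = "norm a" and ?B = "norm b"
  have i: "a \<bullet> b = (?A\<^sup>2 + ?B\<^sup>2 - (norm (a - b))\<^sup>2) / 2"
    by (simp add: power2_norm_eq_inner inner_diff_left inner_diff_right inner_commute)
  have "(?A *\<^sub>R a - ?B *\<^sub>R b) \<bullet> (a - b) = ?A * ?A\<^sup>2 + ?B * ?B\<^sup>2 - (?A + ?B) * (a \<bullet> b)"
    by (simp add: inner_diff_left inner_diff_right inner_commute power2_norm_eq_inner algebra_simps)
  also have "\<dots> = (?A + ?B) * (norm (a - b))\<^sup>2 / 2 + (?A + ?B) * (?A - ?B)\<^sup>2 / 2"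
    unfolding i by (simp add: field_simps power2_eq_square)
  finally have "(?A + ?B) * (norm (a - b))\<^sup>2 / 2 \<le> (?A *\<^sub>R a - ?B *\<^sub>R b) \<bullet> (a - b)"
    by simp
  also have "\<dots> \<le> norm (?A *\<^sub>R a - ?B *\<^sub>R b) * norm (a - b)"
    by (rule norm_cauchy_schwarz)
  finally have "(?A + ?B) * (norm (a - b))\<^sup>2 / 2 \<le> norm (?A *\<^sub>R a - ?B *\<^sub>R b) * norm (a - b)" .
  moreover have "norm (a - b) * (norm (a - b))\<^sup>2 / 2 \<le> (?A + ?B) * (norm (a - b))\<^sup>2 / 2"
    by (intro divide_right_mono mult_right_mono norm_triangle_ineq4) auto
  ultimately have "norm (a - b) * ((norm (a - b))\<^sup>2 / 2) \<le> norm (a - b) * norm (?A *\<^sub>R a - ?B *\<^sub>R b)"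
    by (simp add: mult_ac)
  then show ?thesis using False by simp
qed simp

lemma square_integrable_translation:
  assumes g: "square_integrable g"
  shows "square_integrable (\<lambda>x. g (x + w))" "L2_norm (\<lambda>x. g (x + w)) = L2_norm g"
  using lborel_translation[OF square_integrableD(2)[OF g], of w] square_integrableD(1)[OF g]
  by (auto simp: square_integrable_def L2_norm_def)

text \<open>
  If \<open>g\<close> is square integrable then \<open>x \<mapsto> \<parallel>g x\<parallel> g x\<close> is integrable, and its translations are
  continuous in \<open>L\<^sup>1\<close>.
\<close>
lemma L2_translation_continuous:
  fixes g :: "'a::euclidean_space \<Rightarrow> complex"
  assumes g: "square_integrable g" and w: "w \<longlonglongrightarrow> 0"
  shows "(\<lambda>k. (L2_norm (\<lambda>x. g (x + w k) - g x))\<^sup>2) \<longlonglongrightarrow> 0"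
proof (rule tendsto_sandwich[OF _ _ tendsto_const])
  note [measurable] = square_integrableD(1)[OF g]
  let ?f = "\<lambda>x. norm (g x) *\<^sub>R g x"
  have f: "integrable lborel ?f"
    by (rule Bochner_Integration.integrable_bound[OF square_integrableD(2)[OF g]])
       (auto simp: power2_eq_square)
  show "(\<lambda>k. 2 * (LINT x|lborel. norm (?f (x + w k) - ?f x))) \<longlonglongrightarrow> 0"
    using tendsto_mult_right_zero[OF L1_translation_continuous[OF f w]] .
  have "(L2_norm (\<lambda>x. g (x + w k) - g x))\<^sup>2 \<le> 2 * (LINT x|lborel. norm (?f (x + w k) - ?f x))" for k
  proof -
    note d = square_integrable_diff[OF square_integrable_translation(1)[OF g, of "w k"] g]
    have "(L2_norm (\<lambda>x. g (x + w k) - g x))\<^sup>2 \<le> (LINT x|lborel. 2 * norm (?f (x + w k) - ?f x))"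
      unfolding L2_norm_power2
      by (rule integral_mono)
         (use square_integrableD(2)[OF d] lborel_translation(1)[OF f, of "w k"] f
           power2_dist_le_dist_signed_square in auto)
    then show ?thesis by simp
  qed
  then show "\<forall>\<^sub>F k in sequentially. (L2_norm (\<lambda>x. g (x + w k) - g x))\<^sup>2
      \<le> 2 * (LINT x|lborel. norm (?f (x + w k) - ?f x))" by simp
qed simp

section \<open>Plancherel for integrable functions\<close>

definition fourier_integral :: "('a::euclidean_space \<Rightarrow> complex) \<Rightarrow> 'a \<Rightarrow> complex" where
  "fourier_integral g \<xi> = complex_of_real ((2 * pi) powr (- (real DIM('a) / 2))) *
     (LINT x|lborel. exp (- (\<i> * complex_of_real (\<xi> \<bullet> x))) * g x)"

lemma fourier_constant: "(2 * pi) powr (- (real n / 2)) * sqrt (2 * pi) ^ n = 1"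
proof -
  have "sqrt (2 * pi) ^ n = (2 * pi) powr (real n / 2)"
    by (simp add: powr_half_sqrt[symmetric] powr_powr flip: powr_realpow)
  then show ?thesis by (simp add: powr_minus)
qed

lemma borel_measurable_fourier_integral:
  assumes [measurable]: "g \<in> borel_measurable borel"
  shows "fourier_integral g \<in> borel_measurable borel"
  unfolding fourier_integral_def by measurable

lemma norm_fourier_integral_le:
  fixes g :: "'a::euclidean_space \<Rightarrow> complex"
  shows "cmod (fourier_integral g \<xi>) \<le> (2 * pi) powr (- (real DIM('a) / 2)) * (LINT x|lborel. cmod (g x))"
proof -
  have "cmod (LINT x|lborel. exp (- (\<i> * complex_of_real (\<xi> \<bullet> x))) * g x)
      \<le> (LINT x|lborel. cmod (exp (- (\<i> * complex_of_real (\<xi> \<bullet> x))) * g x))"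
    by (rule integral_norm_bound)
  also have "\<dots> = (LINT x|lborel. cmod (g x))" by (simp add: norm_mult)
  finally show ?thesis by (simp add: fourier_integral_def norm_mult)
qed

text \<open>
  Fourier inversion with a Gaussian cutoff. Exchanging the integrals leaves the Fourier transform
  of the dilated Gaussian, which is again a Gaussian; the substitution \<open>y = x + s v\<close> absorbs the
  factor \<open>s\<^bsup>-n\<^esup>\<close>, and the powers of \<open>2\<pi>\<close> cancel by \<open>fourier_constant\<close>.
\<close>
lemma gaussian_regularized_inversion:
  fixes g :: "'a::euclidean_space \<Rightarrow> complex" and x :: 'a
  assumes g: "integrable lborel g" and s: "0 < s"
  shows "(LINT \<xi>|lborel. exp (\<i> * complex_of_real (\<xi> \<bullet> x)) *
      (fourier_integral g \<xi> * complex_of_real (gaussian (s *\<^sub>R \<xi>))))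
    = (LINT v|lborel. complex_of_real (gaussian v) * g (x + s *\<^sub>R v))"
proof -
  have [measurable]: "g \<in> borel_measurable borel" using borel_measurable_integrable[OF g] by simp
  let ?c = "(2 * pi) powr (- (real DIM('a) / 2))"
  let ?a = "\<lambda>\<xi>. iexp (\<xi> \<bullet> x) * complex_of_real (gaussian (s *\<^sub>R \<xi>))"
  have ig: "integrable lborel (\<lambda>\<xi>::'a. gaussian (s *\<^sub>R \<xi>))"
    using lborel_affine_substitution(1)[OF integrable_gaussian, of s 0] s by simp
  have ia: "integrable lborel ?a"
    by (rule Bochner_Integration.integrable_bound[OF ig]) (auto simp: norm_mult)
  have inner: "(LINT \<xi>|lborel. exp (- (\<i> * complex_of_real (\<xi> \<bullet> y))) * ?a \<xi>)
      = complex_of_real (sqrt (2 * pi) ^ DIM('a) / s ^ DIM('a) * gaussian ((y - x) /\<^sub>R s))" for y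
  proof -
    let ?w = "(x - y) /\<^sub>R s"
    let ?h = "\<lambda>v. iexp (?w \<bullet> v) * complex_of_real (gaussian v)"
    have shift: "exp (- (\<i> * complex_of_real (\<xi> \<bullet> y))) * ?a \<xi> = ?h (0 + s *\<^sub>R \<xi>)" for \<xi>
    proof -
      have w: "?w \<bullet> (0 + s *\<^sub>R \<xi>) = \<xi> \<bullet> x - \<xi> \<bullet> y"
        using s by (simp add: inner_diff_left inner_commute[of x] inner_commute[of y])
      have e: "exp (- (\<i> * complex_of_real p)) * iexp q = iexp (q - p)" for p q
        by (simp add: right_diff_distrib flip: exp_add)
      show ?thesis unfolding w by (simp only: e[symmetric] mult.assoc add_0)
    qed
    have "s ^ DIM('a) *\<^sub>R (LINT \<xi>|lborel. exp (- (\<i> * complex_of_real (\<xi> \<bullet> y))) * ?a \<xi>)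
        = \<bar>s\<bar> ^ DIM('a) *\<^sub>R (LINT \<xi>|lborel. ?h (0 + s *\<^sub>R \<xi>))"
      unfolding shift using s by (simp only: abs_of_pos)
    also have "\<dots> = (LINT v|lborel. ?h v)"
      by (rule lborel_affine_substitution(2)[symmetric, OF gaussian_fourier(1)]) (use s in simp)
    also have "\<dots> = complex_of_real (sqrt (2 * pi) ^ DIM('a) * gaussian ?w)"
      by (rule gaussian_fourier(2))
    also have "gaussian ?w = gaussian ((y - x) /\<^sub>R s)" by (simp add: gaussian_def norm_minus_commute)
    finally show ?thesis using s by (simp add: scaleR_conv_of_real field_simps)
  qed
  have "(LINT \<xi>|lborel. exp (\<i> * complex_of_real (\<xi> \<bullet> x)) *
      (fourier_integral g \<xi> * complex_of_real (gaussian (s *\<^sub>R \<xi>))))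
    = ?c * (LINT \<xi>|lborel. ?a \<xi> * (LINT y|lborel. exp (- (\<i> * complex_of_real (\<xi> \<bullet> y))) * g y))"
    by (subst integral_mult_right_zero[symmetric]) (simp add: fourier_integral_def mult_ac)
  also have "(LINT \<xi>|lborel. ?a \<xi> * (LINT y|lborel. exp (- (\<i> * complex_of_real (\<xi> \<bullet> y))) * g y))
    = (LINT y|lborel. g y * (LINT \<xi>|lborel. exp (- (\<i> * complex_of_real (\<xi> \<bullet> y))) * ?a \<xi>))"
    by (rule Fubini_bounded_kernel[OF ia g]) auto
  also have "\<dots> = (LINT y|lborel. complex_of_real (sqrt (2 * pi) ^ DIM('a) / s ^ DIM('a)) *
      (complex_of_real (gaussian ((y - x) /\<^sub>R s)) * g y))"
    unfolding inner by (simp add: mult_ac)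
  also have "\<dots> = complex_of_real (sqrt (2 * pi) ^ DIM('a) / s ^ DIM('a)) *
      (LINT y|lborel. complex_of_real (gaussian ((y - x) /\<^sub>R s)) * g y)"
    by (rule integral_mult_right_zero)
  also have "(LINT y|lborel. complex_of_real (gaussian ((y - x) /\<^sub>R s)) * g y)
      = s ^ DIM('a) *\<^sub>R (LINT v|lborel. complex_of_real (gaussian v) * g (x + s *\<^sub>R v))"
  proof -
    have "integrable lborel (\<lambda>y. complex_of_real (gaussian ((y - x) /\<^sub>R s)) * g y)"
      by (rule Bochner_Integration.integrable_bound[OF g]) (auto simp: norm_mult intro!: mult_left_le_one_le)
    from lborel_affine_substitution(2)[OF this, of s x] show ?thesis using s by simp
  qed
  finally have "(LINT \<xi>|lborel. exp (\<i> * complex_of_real (\<xi> \<bullet> x)) *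
      (fourier_integral g \<xi> * complex_of_real (gaussian (s *\<^sub>R \<xi>))))
    = complex_of_real (?c * sqrt (2 * pi) ^ DIM('a)) *
      (LINT v|lborel. complex_of_real (gaussian v) * g (x + s *\<^sub>R v))"
    using s by (simp add: scaleR_conv_of_real)
  then show ?thesis by (simp only: fourier_constant) simp
qed

lemma square_integrable_cnj:
  assumes "square_integrable g"
  shows "square_integrable (\<lambda>x. cnj (g x))"
proof -
  have [measurable]: "cnj \<in> borel_measurable borel"
    by (intro borel_measurable_continuous_onI continuous_intros)
  note [measurable] = square_integrableD(1)[OF assms]
  show ?thesis using assms by (simp add: square_integrable_def)
qed

text \<open>
  Polarization: \<open>Re (cnj a \<cdot> b)\<close> is \<open>(\<bar>a\<bar>\<^sup>2 + \<bar>b\<bar>\<^sup>2 - \<bar>b - a\<bar>\<^sup>2)/2\<close>, and a shift preserves the norm.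
  In this form only the \<open>L\<^sup>2\<close> modulus of continuity of \<open>g\<close> appears.
\<close>
lemma Re_autocorrelation:
  assumes g: "square_integrable g"
  shows "Re (LINT x|lborel. cnj (g x) * g (x + w))
    = (L2_norm g)\<^sup>2 - (L2_norm (\<lambda>x. g (x + w) - g x))\<^sup>2 / 2"
proof -
  note gt = square_integrable_translation[OF g, of w]
  note d = square_integrable_diff[OF gt(1) g]
  have i: "integrable lborel (\<lambda>x. cnj (g x) * g (x + w))"
    using square_integrable_cnj[OF g] gt(1) by (rule integrable_mult_of_square_integrable)
  have "Re (cnj u * z) = (cmod u)\<^sup>2 / 2 + (cmod z)\<^sup>2 / 2 - (cmod (z - u))\<^sup>2 / 2" for u z
    unfolding cmod_power2 by (simp add: power2_eq_square field_simps)
  then have "Re (LINT x|lborel. cnj (g x) * g (x + w))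
      = (LINT x|lborel. (cmod (g x))\<^sup>2 / 2 + (cmod (g (x + w)))\<^sup>2 / 2 - (cmod (g (x + w) - g x))\<^sup>2 / 2)"
    using i by (simp flip: integral_Re)
  also have "\<dots> = (L2_norm g)\<^sup>2 / 2 + (L2_norm (\<lambda>x. g (x + w)))\<^sup>2 / 2 - (L2_norm (\<lambda>x. g (x + w) - g x))\<^sup>2 / 2"
    using square_integrableD(2)[OF g] square_integrableD(2)[OF gt(1)] square_integrableD(2)[OF d]
    by (simp add: L2_norm_power2)
  finally show ?thesis by (simp add: gt(2))
qed

text \<open>
  Writing \<open>\<bar>F\<bar>\<^sup>2 = F \<cdot> cnj F\<close> and expanding \<open>cnj F\<close> as an integral over \<open>x\<close>, Fubini produces the
  regularized inversion of \<open>F\<close> at \<open>x\<close>. A second application of Fubini collects the autocorrelations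
  of \<open>g\<close> at the shifts \<open>s v\<close>. The left-hand side is real, so taking real parts loses nothing.
\<close>
lemma gaussian_weighted_energy:
  fixes g :: "'a::euclidean_space \<Rightarrow> complex"
  assumes g: "integrable lborel g" and g2: "square_integrable g" and s: "0 < s"
  shows "integrable lborel (\<lambda>\<xi>. (cmod (fourier_integral g \<xi>))\<^sup>2 * gaussian (s *\<^sub>R \<xi>))"
    and "(LINT \<xi>|lborel. (cmod (fourier_integral g \<xi>))\<^sup>2 * gaussian (s *\<^sub>R \<xi>))
      = (2 * pi) powr (- (real DIM('a) / 2)) * (LINT v::'a|lborel. gaussian v *
          ((L2_norm g)\<^sup>2 - (L2_norm (\<lambda>x. g (x + s *\<^sub>R v) - g x))\<^sup>2 / 2))"
proof -
  have [measurable]: "g \<in> borel_measurable borel" using borel_measurable_integrable[OF g] by simp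
  note [measurable] = borel_measurable_fourier_integral[of g]
  let ?c = "(2 * pi) powr (- (real DIM('a) / 2))"
  let ?F = "fourier_integral g"
  let ?E = "\<lambda>\<xi>::'a. gaussian (s *\<^sub>R \<xi>)"
  have iE: "integrable lborel ?E"
    using lborel_affine_substitution(1)[OF integrable_gaussian, of s 0] s by simp
  \<comment> \<open>Boundedness of the transform makes its product with the weight integrable.\<close>
  let ?B = "?c * (LINT x|lborel. cmod (g x))"
  have B: "cmod (?F \<xi>) \<le> ?B" for \<xi> by (rule norm_fourier_integral_le)
  have B0: "0 \<le> ?B" by simp
  have iFE: "integrable lborel (\<lambda>\<xi>. ?F \<xi> * complex_of_real (?E \<xi>))"
    by (rule Bochner_Integration.integrable_bound[where g="\<lambda>\<xi>. ?F \<xi> * complex_of_real (?E \<xi>)" and f="\<lambda>\<xi>. ?B * ?E \<xi>"])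
       (use iE B in \<open>auto simp: norm_mult intro!: mult_right_mono\<close>)
  show "integrable lborel (\<lambda>\<xi>. (cmod (?F \<xi>))\<^sup>2 * ?E \<xi>)"
  proof (rule Bochner_Integration.integrable_bound)
    show "integrable lborel (\<lambda>\<xi>. ?B\<^sup>2 * ?E \<xi>)" using iE by simp
    show "AE \<xi> in lborel. norm ((cmod (?F \<xi>))\<^sup>2 * ?E \<xi>) \<le> norm (?B\<^sup>2 * ?E \<xi>)"
      using power_mono[OF B norm_ge_zero, of _ 2] by (auto simp: abs_mult intro!: mult_right_mono)
  qed simp
  have icg: "integrable lborel (\<lambda>x. cnj (g x))" using g by simp
  note g2c = square_integrable_cnj[OF g2]
  have [measurable]: "(\<lambda>x. cnj (g x)) \<in> borel_measurable borel" using g2c by (rule square_integrableD)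
  have cnjF: "cnj (?F \<xi>) = complex_of_real ?c * (LINT x|lborel. iexp (\<xi> \<bullet> x) * cnj (g x))" for \<xi>
  proof -
    have "cnj (LINT x|lborel. exp (- (\<i> * complex_of_real (\<xi> \<bullet> x))) * g x)
        = (LINT x|lborel. iexp (\<xi> \<bullet> x) * cnj (g x))"
      by (subst Bochner_Integration.integral_cnj[symmetric]) (simp add: exp_cnj)
    then show ?thesis by (simp add: fourier_integral_def)
  qed
  let ?P = "\<lambda>v. LINT x|lborel. complex_of_real (gaussian v) * (cnj (g x) * g (x + s *\<^sub>R v))"
  have int: "integrable (lborel \<Otimes>\<^sub>M lborel)
    (\<lambda>(v::'a, x). complex_of_real (gaussian v) * (cnj (g x) * g (x + s *\<^sub>R v)))"
  proof (rule lborel_pair.Fubini_integrable)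
    have "cmod (LINT x|lborel. complex_of_real (cmod (g x) * cmod (g (x + w)))) \<le> (L2_norm g)\<^sup>2" for w
      using integrable_mult_of_square_integrable(2)[OF g2 square_integrable_translation(1)[OF g2, of w]]
      by (simp add: square_integrable_translation(2)[OF g2] del: of_real_mult)
    then have le: "(LINT x|lborel. cmod (g x) * cmod (g (x + w))) \<le> (L2_norm g)\<^sup>2" for w
      by (simp del: of_real_mult)
    show "integrable lborel (\<lambda>v::'a. LINT x|lborel. norm
      (case (v, x) of (v, x) \<Rightarrow> complex_of_real (gaussian v) * (cnj (g x) * g (x + s *\<^sub>R v))))"
      by (rule Bochner_Integration.integrable_bound[where f="\<lambda>v::'a. (L2_norm g)\<^sup>2 * gaussian v"])
         (use integrable_gaussian le in \<open>auto simp: norm_mult mult.commute intro!: mult_left_mono\<close>)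
    show "AE v in lborel. integrable lborel
      (\<lambda>x. case (v, x) of (v, x) \<Rightarrow> complex_of_real (gaussian v) * (cnj (g x) * g (x + s *\<^sub>R v)))"
      using integrable_mult_of_square_integrable(1)[OF g2c square_integrable_translation(1)[OF g2]]
      by simp
  qed simp
  have iP: "integrable lborel ?P"
    using lborel_pair.integrable_fst[OF int] by simp
  have "complex_of_real (LINT \<xi>|lborel. (cmod (?F \<xi>))\<^sup>2 * ?E \<xi>)
      = (LINT \<xi>|lborel. complex_of_real ((cmod (?F \<xi>))\<^sup>2 * ?E \<xi>))"
    by (rule integral_complex_of_real[symmetric])
  also have "\<dots> = (LINT \<xi>|lborel. complex_of_real ?c * ((?F \<xi> * complex_of_real (?E \<xi>)) * (LINT x|lborel. iexp (\<xi> \<bullet> x) * cnj (g x))))"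
  proof (intro Bochner_Integration.integral_cong refl)
    fix \<xi>
    have "complex_of_real ((cmod (?F \<xi>))\<^sup>2 * ?E \<xi>) = ?F \<xi> * complex_of_real (?E \<xi>) * cnj (?F \<xi>)"
      by (simp add: complex_norm_square mult_ac del: of_real_power)
    then show "complex_of_real ((cmod (?F \<xi>))\<^sup>2 * ?E \<xi>) = complex_of_real ?c * ((?F \<xi> * complex_of_real (?E \<xi>)) * (LINT x|lborel. iexp (\<xi> \<bullet> x) * cnj (g x)))"
      unfolding cnjF by (simp add: mult_ac)
  qed
  also have "\<dots> = complex_of_real ?c * (LINT \<xi>|lborel. (?F \<xi> * complex_of_real (?E \<xi>)) * (LINT x|lborel. iexp (\<xi> \<bullet> x) * cnj (g x)))"
    by (rule integral_mult_right_zero)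
  also have "(LINT \<xi>|lborel. (?F \<xi> * complex_of_real (?E \<xi>)) * (LINT x|lborel. iexp (\<xi> \<bullet> x) * cnj (g x)))
      = (LINT x|lborel. cnj (g x) * (LINT \<xi>|lborel. iexp (\<xi> \<bullet> x) * (?F \<xi> * complex_of_real (?E \<xi>))))"
    by (rule Fubini_bounded_kernel[OF iFE icg]) auto
  also have "\<dots> = (LINT x|lborel. LINT v|lborel. complex_of_real (gaussian v) * (cnj (g x) * g (x + s *\<^sub>R v)))"
    unfolding gaussian_regularized_inversion[OF g s]
    by (simp add: mult_ac flip: integral_mult_right_zero)
  also have "\<dots> = (LINT v|lborel. ?P v)"
    by (rule lborel_pair.Fubini_integral[OF int])
  finally have "complex_of_real (LINT \<xi>|lborel. (cmod (?F \<xi>))\<^sup>2 * ?E \<xi>) = complex_of_real ?c * (LINT v|lborel. ?P v)" .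
  then have "Re (complex_of_real (LINT \<xi>|lborel. (cmod (?F \<xi>))\<^sup>2 * ?E \<xi>)) = Re (complex_of_real ?c * (LINT v|lborel. ?P v))"
    by (rule arg_cong)
  then have "(LINT \<xi>|lborel. (cmod (?F \<xi>))\<^sup>2 * ?E \<xi>) = ?c * (LINT v|lborel. Re (?P v))"
    unfolding integral_Re[OF iP] by simp
  also have "(\<lambda>v. Re (?P v)) = (\<lambda>v. gaussian v *
      ((L2_norm g)\<^sup>2 - (L2_norm (\<lambda>x. g (x + s *\<^sub>R v) - g x))\<^sup>2 / 2))"
    unfolding integral_mult_right_zero by (simp add: Re_autocorrelation[OF g2])
  finally show "(LINT \<xi>|lborel. (cmod (?F \<xi>))\<^sup>2 * ?E \<xi>)
      = ?c * (LINT v|lborel. gaussian v * ((L2_norm g)\<^sup>2 - (L2_norm (\<lambda>x. g (x + s *\<^sub>R v) - g x))\<^sup>2 / 2))" .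
qed

text \<open>
  Let \<open>s\<close> decrease to 0 in \<open>gaussian_weighted_energy\<close>: the left-hand side converges monotonically
  to the energy of the transform, the right-hand side by dominated convergence to \<open>\<parallel>g\<parallel>\<^sup>2\<close>, since the
  total mass of the Gaussian cancels the normalizing constant. Monotone convergence also yields the
  square integrability of the transform.
\<close>
lemma Plancherel_integrable:
  fixes g :: "'a::euclidean_space \<Rightarrow> complex"
  assumes g: "integrable lborel g" and g2: "square_integrable g"
  shows "square_integrable (fourier_integral g)" "L2_norm (fourier_integral g) = L2_norm g"
proof -
  have [measurable]: "g \<in> borel_measurable borel" using borel_measurable_integrable[OF g] by simp
  note F[measurable] = borel_measurable_fourier_integral[of g]
  let ?c = "(2 * pi) powr (- (real DIM('a) / 2))"
  define s where "s k = inverse (real (Suc k))" for k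
  have s: "0 < s k" for k by (simp add: s_def)
  have s_lim: "s \<longlonglongrightarrow> 0" unfolding s_def[abs_def] by (rule LIMSEQ_inverse_real_of_nat)
  let ?D = "\<lambda>w. (L2_norm (\<lambda>x. g (x + w) - g x))\<^sup>2"
  have D_meas[measurable]: "?D \<in> borel_measurable borel" unfolding L2_norm_power2 by measurable
  have D_le: "?D w \<le> 4 * (L2_norm g)\<^sup>2" for w
  proof -
    have "L2_norm (\<lambda>x. g (x + w) - g x) \<le> L2_norm (\<lambda>x. g (x + w)) + L2_norm (\<lambda>x. - 1 * g x)"
      using L2_norm_triangle[OF square_integrable_translation(1)[OF g2, of w] square_integrable_cmult[OF g2, of "- 1"]]
      by simp
    also have "\<dots> = 2 * L2_norm g" by (simp add: square_integrable_translation(2)[OF g2]) (simp add: L2_norm_def)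
    finally have "?D w \<le> (2 * L2_norm g)\<^sup>2" by (intro power_mono) auto
    then show ?thesis by (simp add: power_mult_distrib)
  qed
  have lim: "(\<lambda>k. LINT v|lborel. gaussian v * ((L2_norm g)\<^sup>2 - ?D (s k *\<^sub>R v) / 2))
      \<longlonglongrightarrow> (LINT v::'a|lborel. gaussian v * (L2_norm g)\<^sup>2)"
  proof (rule integral_dominated_convergence[where w="\<lambda>v. gaussian v * (L2_norm g)\<^sup>2"])
    show "AE v in lborel. (\<lambda>k. gaussian v * ((L2_norm g)\<^sup>2 - ?D (s k *\<^sub>R v) / 2)) \<longlonglongrightarrow> gaussian v * (L2_norm g)\<^sup>2"
    proof (rule AE_I2)
      fix v :: 'a
      have "(\<lambda>k. s k *\<^sub>R v) \<longlonglongrightarrow> 0" using tendsto_scaleR[OF s_lim tendsto_const, of v] by simp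
      from L2_translation_continuous[OF g2 this]
      have "(\<lambda>k. gaussian v * ((L2_norm g)\<^sup>2 - ?D (s k *\<^sub>R v) / 2)) \<longlonglongrightarrow> gaussian v * ((L2_norm g)\<^sup>2 - 0 / 2)"
        by (intro tendsto_intros) auto
      then show "(\<lambda>k. gaussian v * ((L2_norm g)\<^sup>2 - ?D (s k *\<^sub>R v) / 2)) \<longlonglongrightarrow> gaussian v * (L2_norm g)\<^sup>2" by simp
    qed
    show "AE v in lborel. norm (gaussian v * ((L2_norm g)\<^sup>2 - ?D (s k *\<^sub>R v) / 2)) \<le> gaussian v * (L2_norm g)\<^sup>2" for k
    proof (rule AE_I2)
      fix v :: 'a
      have "\<bar>(L2_norm g)\<^sup>2 - ?D (s k *\<^sub>R v) / 2\<bar> \<le> (L2_norm g)\<^sup>2"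
        using D_le[of "s k *\<^sub>R v"] zero_le_power2[of "L2_norm (\<lambda>x. g (x + s k *\<^sub>R v) - g x)"]
        by (simp add: abs_le_iff)
      then show "norm (gaussian v * ((L2_norm g)\<^sup>2 - ?D (s k *\<^sub>R v) / 2)) \<le> gaussian v * (L2_norm g)\<^sup>2"
        by (simp add: abs_mult mult_left_mono)
    qed
  qed (use integrable_gaussian in auto)
  have "(\<lambda>k. LINT \<xi>|lborel. (cmod (fourier_integral g \<xi>))\<^sup>2 * gaussian (s k *\<^sub>R \<xi>))
      \<longlonglongrightarrow> ?c * (LINT v::'a|lborel. gaussian v * (L2_norm g)\<^sup>2)"
    unfolding gaussian_weighted_energy(2)[OF g g2 s] by (intro tendsto_intros lim)
  also have "?c * (LINT v::'a|lborel. gaussian v * (L2_norm g)\<^sup>2) = (?c * sqrt (2 * pi) ^ DIM('a)) * (L2_norm g)\<^sup>2"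
    by (simp add: integral_gaussian)
  also have "\<dots> = (L2_norm g)\<^sup>2" by (simp only: fourier_constant mult_1)
  finally have ilim: "(\<lambda>k. LINT \<xi>|lborel. (cmod (fourier_integral g \<xi>))\<^sup>2 * gaussian (s k *\<^sub>R \<xi>)) \<longlonglongrightarrow> (L2_norm g)\<^sup>2" .
  have mono: "AE \<xi> in lborel. mono (\<lambda>k. (cmod (fourier_integral g \<xi>))\<^sup>2 * gaussian (s k *\<^sub>R \<xi>))"
  proof (intro AE_I2 monoI mult_left_mono)
    fix \<xi> :: 'a and j k :: nat assume "j \<le> k"
    then have "s k \<le> s j" by (simp add: s_def)
    then have "s k * norm \<xi> \<le> s j * norm \<xi>" by (intro mult_right_mono) auto
    then have "(s k * norm \<xi>)\<^sup>2 \<le> (s j * norm \<xi>)\<^sup>2" using s[of k] by (intro power_mono) auto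
    then show "gaussian (s j *\<^sub>R \<xi>) \<le> gaussian (s k *\<^sub>R \<xi>)"
      using s[of k] s[of j] by (simp add: gaussian_def)
  qed simp
  have plim: "AE \<xi> in lborel. (\<lambda>k. (cmod (fourier_integral g \<xi>))\<^sup>2 * gaussian (s k *\<^sub>R \<xi>))
      \<longlonglongrightarrow> (cmod (fourier_integral g \<xi>))\<^sup>2"
  proof (rule AE_I2)
    fix \<xi> :: 'a
    have "(\<lambda>k. (cmod (fourier_integral g \<xi>))\<^sup>2 * gaussian (s k *\<^sub>R \<xi>))
      \<longlonglongrightarrow> (cmod (fourier_integral g \<xi>))\<^sup>2 * exp (- (norm (0 *\<^sub>R \<xi>))\<^sup>2 / 2)"
      unfolding gaussian_def by (intro tendsto_intros s_lim) simp
    then show "(\<lambda>k. (cmod (fourier_integral g \<xi>))\<^sup>2 * gaussian (s k *\<^sub>R \<xi>))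
      \<longlonglongrightarrow> (cmod (fourier_integral g \<xi>))\<^sup>2" by simp
  qed
  note R = integrable_monotone_convergence[OF gaussian_weighted_energy(1)[OF g g2 s] mono plim ilim]
    integral_monotone_convergence[OF gaussian_weighted_energy(1)[OF g g2 s] mono plim ilim]
  show "square_integrable (fourier_integral g)"
    using R(1) by (simp add: square_integrable_def F)
  have "(L2_norm (fourier_integral g))\<^sup>2 = (L2_norm g)\<^sup>2"
    using R(2) by (simp add: L2_norm_power2)
  then show "L2_norm (fourier_integral g) = L2_norm g" by simp
qed

section \<open>Completeness of the space of square-integrable functions\<close>

lemma square_integrable_of_nn_integral:
  assumes "h \<in> borel_measurable borel" and le: "(\<integral>\<^sup>+x. ennreal ((cmod (h x))\<^sup>2) \<partial>lborel) \<le> ennreal (c\<^sup>2)" and c: "0 \<le> c"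
  shows "square_integrable h" "L2_norm h \<le> c"
proof -
  note assms(1)[measurable]
  have "integrable lborel (\<lambda>x. (cmod (h x))\<^sup>2)"
    unfolding integrable_iff_bounded using le ennreal_less_top order_le_less_trans by fastforce
  then show sq: "square_integrable h" using assms(1) by (simp add: square_integrable_def)
  have "ennreal ((L2_norm h)\<^sup>2) \<le> ennreal (c\<^sup>2)" using le nn_integral_cmod_power2[OF sq] by simp
  then have "(L2_norm h)\<^sup>2 \<le> c\<^sup>2" by simp
  then show "L2_norm h \<le> c" using c by (rule power2_le_imp_le)
qed

text \<open>
  The integral of \<open>\<Sum>k. 2\<^sup>k \<bar>d\<^sub>k\<bar>\<^sup>2\<close>, with \<open>d\<^sub>k\<close> the successive differences, is at most
  \<open>\<Sum>k. 2\<^bsup>-k\<^esup>\<close>, so the sum is finite almost everywhere. Since \<open>2 \<bar>d\<bar> \<le> 2\<^sup>k \<bar>d\<bar>\<^sup>2 + 2\<^bsup>-k\<^esup>\<close>, the differences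
  are then absolutely summable there.
\<close>
lemma L2_fast_Cauchy_converges_AE:
  fixes F :: "nat \<Rightarrow> 'a::euclidean_space \<Rightarrow> complex"
  assumes F: "\<And>k. square_integrable (F k)"
    and fast: "\<And>k. L2_norm (\<lambda>x. F (Suc k) x - F k x) \<le> (1 / 2) ^ k"
  shows "AE x in lborel. convergent (\<lambda>k. F k x)"
proof -
  note [measurable] = square_integrableD(1)[OF F]
  let ?d = "\<lambda>k x. F (Suc k) x - F k x"
  have "(\<integral>\<^sup>+x. (\<Sum>k. ennreal (2 ^ k * (cmod (?d k x))\<^sup>2)) \<partial>lborel)
      = (\<Sum>k. \<integral>\<^sup>+x. ennreal (2 ^ k * (cmod (?d k x))\<^sup>2) \<partial>lborel)"
    by (rule nn_integral_suminf) simp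
  also have "\<dots> \<le> (\<Sum>k. ennreal ((1 / 2) ^ k))"
  proof (rule suminf_le)
    fix k
    have "(\<integral>\<^sup>+x. ennreal (2 ^ k * (cmod (?d k x))\<^sup>2) \<partial>lborel) = ennreal (2 ^ k * (L2_norm (?d k))\<^sup>2)"
      by (simp add: ennreal_mult nn_integral_cmult nn_integral_cmod_power2[OF square_integrable_diff[OF F F]])
    also have "\<dots> \<le> ennreal (2 ^ k * ((1 / 2) ^ k)\<^sup>2)"
      using power_mono[OF fast[of k] L2_norm_nonneg, of 2] by (intro ennreal_leI mult_left_mono) auto
    also have "2 ^ k * ((1 / 2) ^ k)\<^sup>2 = (1 / 2 :: real) ^ k"
      by (simp add: power2_eq_square power_divide)
    finally show "(\<integral>\<^sup>+x. ennreal (2 ^ k * (cmod (?d k x))\<^sup>2) \<partial>lborel) \<le> ennreal ((1 / 2) ^ k)" .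
  qed auto
  also have "\<dots> < \<infinity>"
  proof -
    have "(\<Sum>k. ennreal ((1 / 2) ^ k)) \<noteq> top"
      by (rule ennreal_suminf_neq_top) (auto intro: summable_geometric)
    then show ?thesis by (simp only: infinity_ennreal_def less_top)
  qed
  finally have "AE x in lborel. (\<Sum>k. ennreal (2 ^ k * (cmod (?d k x))\<^sup>2)) \<noteq> \<infinity>"
    by (intro nn_integral_PInf_AE) auto
  then show ?thesis
  proof eventually_elim
    case (elim x)
    then have s: "summable (\<lambda>k. 2 ^ k * (cmod (?d k x))\<^sup>2)"
      by (intro summable_suminf_not_top) auto
    have "summable (\<lambda>k. 2 ^ k * (cmod (?d k x))\<^sup>2 + (1 / 2 :: real) ^ k)"
      using s by (intro summable_add summable_geometric) auto
    then have "summable (\<lambda>k. ?d k x)"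
    proof (rule summable_comparison_test'[where N=0])
      fix k
      let ?r = "cmod (?d k x)"
      have "2 * (2 ^ k * ?r) \<le> (2 ^ k * ?r)\<^sup>2 + 1"
        using sum_squares_bound[of "2 ^ k * ?r" 1] by simp
      then have "2 ^ k * (2 * ?r) \<le> 2 ^ k * (2 ^ k * ?r\<^sup>2 + (1 / 2) ^ k)"
        by (simp add: power2_eq_square distrib_left power_one_over mult_ac)
      then have "2 * ?r \<le> 2 ^ k * ?r\<^sup>2 + (1 / 2) ^ k" by simp
      then show "norm (?d k x) \<le> 2 ^ k * ?r\<^sup>2 + (1 / 2) ^ k"
        using norm_ge_zero[of "?d k x"] by linarith
    qed
    then have "(\<lambda>n. F n x - F 0 x) \<longlonglongrightarrow> (\<Sum>k. ?d k x)"
      using summable_LIMSEQ sum_lessThan_telescope[of "\<lambda>k. F k x"] by fastforce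
    from tendsto_add[OF this tendsto_const[of "F 0 x"]]
    show "convergent (\<lambda>k. F k x)" by (auto simp: convergent_def)
  qed
qed

text \<open>
  The candidate is the pointwise limit along a rapidly converging subsequence; Fatou's lemma bounds
  its distance to every late member of the whole sequence.
\<close>
lemma L2_complete:
  fixes F :: "nat \<Rightarrow> 'a::euclidean_space \<Rightarrow> complex"
  assumes F: "\<And>k. square_integrable (F k)"
    and Cauchy: "\<And>e. 0 < e \<Longrightarrow> \<exists>N. \<forall>m\<ge>N. \<forall>n\<ge>N. L2_norm (\<lambda>x. F m x - F n x) \<le> e"
  shows "\<exists>h. square_integrable h \<and> (\<lambda>k. L2_norm (\<lambda>x. h x - F k x)) \<longlonglongrightarrow> 0"
proof -
  note [measurable] = square_integrableD(1)[OF F]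
  have "\<forall>k. \<exists>N. \<forall>m\<ge>N. \<forall>n\<ge>N. L2_norm (\<lambda>x. F m x - F n x) \<le> (1 / 2) ^ k"
    by (intro allI Cauchy) simp
  then obtain N where N: "\<And>k m n. N k \<le> m \<Longrightarrow> N k \<le> n \<Longrightarrow> L2_norm (\<lambda>x. F m x - F n x) \<le> (1 / 2) ^ k"
    by metis
  \<comment> \<open>The sum makes the indices increase and dominate \<open>N\<close>; the summand \<open>k\<close> makes them unbounded.\<close>
  define r where "r k = k + (\<Sum>j\<le>k. N j)" for k
  have r: "N k \<le> r k" "k \<le> r k" "r k \<le> r (Suc k)" for k
    using member_le_sum[of k "{..k}" N] by (auto simp: r_def)
  have "AE x in lborel. convergent (\<lambda>k. F (r k) x)"
    by (rule L2_fast_Cauchy_converges_AE) (use F N r order_trans in blast)+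
  then have conv: "AE x in lborel. (\<lambda>k. F (r k) x) \<longlonglongrightarrow> lim (\<lambda>k. F (r k) x)"
    by (simp add: convergent_LIMSEQ_iff)
  define h where "h x = lim (\<lambda>k. F (r k) x)" for x
  have h_meas[measurable]: "h \<in> borel_measurable borel" unfolding h_def by measurable
  have close: "square_integrable (\<lambda>x. h x - F m x) \<and> L2_norm (\<lambda>x. h x - F m x) \<le> e"
    if e: "0 < e" and M: "\<And>m n. M \<le> m \<Longrightarrow> M \<le> n \<Longrightarrow> L2_norm (\<lambda>x. F m x - F n x) \<le> e" and m: "M \<le> m" for e M m
  proof -
    have "(\<integral>\<^sup>+x. ennreal ((cmod (h x - F m x))\<^sup>2) \<partial>lborel)
        = (\<integral>\<^sup>+x. liminf (\<lambda>k. ennreal ((cmod (F (r k) x - F m x))\<^sup>2)) \<partial>lborel)"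
    proof (rule nn_integral_cong_AE)
      show "AE x in lborel. ennreal ((cmod (h x - F m x))\<^sup>2) = liminf (\<lambda>k. ennreal ((cmod (F (r k) x - F m x))\<^sup>2))"
        using conv
      proof eventually_elim
        case (elim x)
        then have "(\<lambda>k. ennreal ((cmod (F (r k) x - F m x))\<^sup>2)) \<longlonglongrightarrow> ennreal ((cmod (h x - F m x))\<^sup>2)"
          by (auto simp: h_def intro!: tendsto_intros)
        then show ?case by (rule lim_imp_Liminf[OF sequentially_bot, symmetric])
      qed
    qed
    also have "\<dots> \<le> liminf (\<lambda>k. \<integral>\<^sup>+x. ennreal ((cmod (F (r k) x - F m x))\<^sup>2) \<partial>lborel)"
      by (rule nn_integral_liminf) simp
    also have "\<dots> \<le> liminf (\<lambda>k::nat. ennreal (e\<^sup>2))"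
    proof (rule Liminf_mono)
      have "(\<integral>\<^sup>+x. ennreal ((cmod (F (r k) x - F m x))\<^sup>2) \<partial>lborel) \<le> ennreal (e\<^sup>2)" if "M \<le> k" for k
        using power_mono[OF M[of "r k" m] L2_norm_nonneg, of 2] that r(2)[of k] m
        by (simp add: nn_integral_cmod_power2[OF square_integrable_diff[OF F F]])
      then show "\<forall>\<^sub>F k in sequentially. (\<integral>\<^sup>+x. ennreal ((cmod (F (r k) x - F m x))\<^sup>2) \<partial>lborel) \<le> ennreal (e\<^sup>2)"
        by (auto simp: eventually_sequentially)
    qed
    also have "\<dots> = ennreal (e\<^sup>2)" by (simp add: Liminf_const)
    finally show ?thesis
      using square_integrable_of_nn_integral[of "\<lambda>x. h x - F m x" e] e by auto
  qed
  obtain M1 where "\<And>m n. M1 \<le> m \<Longrightarrow> M1 \<le> n \<Longrightarrow> L2_norm (\<lambda>x. F m x - F n x) \<le> 1"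
    using Cauchy[of 1] by auto
  then have "square_integrable (\<lambda>x. h x - F M1 x)" using close[of 1 M1 M1] by simp
  then have "square_integrable h" using square_integrable_add[OF _ F[of M1]] by fastforce
  moreover have "(\<lambda>k. L2_norm (\<lambda>x. h x - F k x)) \<longlonglongrightarrow> 0"
  proof (rule LIMSEQ_I)
    fix e :: real assume "0 < e"
    then obtain M where "\<And>m n. M \<le> m \<Longrightarrow> M \<le> n \<Longrightarrow> L2_norm (\<lambda>x. F m x - F n x) \<le> e / 2"
      using Cauchy[of "e / 2"] by auto
    then have "L2_norm (\<lambda>x. h x - F k x) \<le> e / 2" if "M \<le> k" for k
      using close[of "e / 2" M k] \<open>0 < e\<close> that by simp
    then show "\<exists>M. \<forall>k\<ge>M. norm (L2_norm (\<lambda>x. h x - F k x) - 0) < e"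
      using \<open>0 < e\<close> by (intro exI[of _ M]) force
  qed
  ultimately show ?thesis by blast
qed

section \<open>The Fourier transform of square-integrable functions\<close>

definition ball_part :: "real \<Rightarrow> ('a::euclidean_space \<Rightarrow> complex) \<Rightarrow> 'a \<Rightarrow> complex" where
  "ball_part R g x = indicator (cball 0 R) x * g x"

lemma truncated_fourier_eq: "truncated_fourier R g = fourier_integral (ball_part R g)"
proof (rule ext)
  fix \<xi>
  have "indicator (cball 0 R) x *\<^sub>R (exp (- (\<i> * complex_of_real (\<xi> \<bullet> x))) * g x)
      = exp (- (\<i> * complex_of_real (\<xi> \<bullet> x))) * ball_part R g x" for x
    by (simp add: ball_part_def split: split_indicator)
  then show "truncated_fourier R g \<xi> = fourier_integral (ball_part R g) \<xi>"
    unfolding truncated_fourier_def fourier_integral_def set_lebesgue_integral_def by (simp only:)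
qed

lemma ball_part:
  fixes g :: "'a::euclidean_space \<Rightarrow> complex"
  assumes g: "square_integrable g"
  shows "square_integrable (ball_part R g)" "integrable lborel (ball_part R g)"
proof -
  show "square_integrable (ball_part R g)"
    unfolding ball_part_def[abs_def]
    by (rule square_integrable_mult_bounded[OF g]) (auto split: split_indicator intro!: borel_measurable_indicator)
  have "emeasure lborel (cball 0 R :: 'a set) < \<infinity>"
    using emeasure_bounded_finite[OF bounded_cball, of 0 R] by simp
  moreover have "(cmod (indicator (cball 0 R) x))\<^sup>2 = indicator (cball 0 R) x" for x :: 'a
    by (simp split: split_indicator)
  moreover have "(\<lambda>x::'a. indicator (cball 0 R) x :: complex) \<in> borel_measurable borel"
    by (auto intro!: borel_measurable_indicator)
  ultimately have "square_integrable (\<lambda>x::'a. indicator (cball 0 R) x)"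
    by (simp add: square_integrable_def)
  from integrable_mult_of_square_integrable(1)[OF this g]
  show "integrable lborel (ball_part R g)" by (simp add: ball_part_def[abs_def])
qed

lemma fourier_integral_diff:
  assumes a: "integrable lborel a" and b: "integrable lborel b"
  shows "fourier_integral (\<lambda>x. a x - b x) \<xi> = fourier_integral a \<xi> - fourier_integral b \<xi>"
proof -
  have [measurable]: "a \<in> borel_measurable borel" "b \<in> borel_measurable borel"
    using borel_measurable_integrable[OF a] borel_measurable_integrable[OF b] by auto
  have "integrable lborel (\<lambda>x. exp (- (\<i> * complex_of_real (\<xi> \<bullet> x))) * a x)"
    by (rule Bochner_Integration.integrable_bound[OF a]) (auto simp: norm_mult)
  moreover have "integrable lborel (\<lambda>x. exp (- (\<i> * complex_of_real (\<xi> \<bullet> x))) * b x)"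
    by (rule Bochner_Integration.integrable_bound[OF b]) (auto simp: norm_mult)
  ultimately show ?thesis
    by (simp add: fourier_integral_def right_diff_distrib)
qed

lemma Plancherel_truncated:
  assumes g: "square_integrable g"
  shows "square_integrable (truncated_fourier R g)"
    and "L2_norm (truncated_fourier R g) = L2_norm (ball_part R g)"
    and "L2_norm (\<lambda>\<xi>. truncated_fourier R g \<xi> - truncated_fourier S g \<xi>)
       = L2_norm (\<lambda>x. ball_part R g x - ball_part S g x)"
proof -
  show "square_integrable (truncated_fourier R g)" "L2_norm (truncated_fourier R g) = L2_norm (ball_part R g)"
    unfolding truncated_fourier_eq using Plancherel_integrable[OF ball_part(2)[OF g] ball_part(1)[OF g]] by auto
  have "(\<lambda>\<xi>. truncated_fourier R g \<xi> - truncated_fourier S g \<xi>)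
      = fourier_integral (\<lambda>x. ball_part R g x - ball_part S g x)"
    by (simp add: truncated_fourier_eq fun_eq_iff fourier_integral_diff[OF ball_part(2)[OF g] ball_part(2)[OF g]])
  then show "L2_norm (\<lambda>\<xi>. truncated_fourier R g \<xi> - truncated_fourier S g \<xi>)
       = L2_norm (\<lambda>x. ball_part R g x - ball_part S g x)"
    using Plancherel_integrable(2)[OF Bochner_Integration.integrable_diff[OF ball_part(2)[OF g] ball_part(2)[OF g]]
      square_integrable_diff[OF ball_part(1)[OF g] ball_part(1)[OF g]]] by simp
qed

lemma L2_norm_minus_commute: "L2_norm (\<lambda>x. a x - b x) = L2_norm (\<lambda>x. b x - a x)"
  by (simp add: L2_norm_def norm_minus_commute)

lemma L2_norm_diff_triangle:
  assumes "square_integrable a" "square_integrable b" "square_integrable c"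
  shows "L2_norm (\<lambda>x. a x - c x) \<le> L2_norm (\<lambda>x. a x - b x) + L2_norm (\<lambda>x. b x - c x)"
  using L2_norm_triangle[OF square_integrable_diff[OF assms(1,2)] square_integrable_diff[OF assms(2,3)]]
  by simp

lemma abs_L2_norm_diff_le:
  assumes a: "square_integrable a" and b: "square_integrable b"
  shows "\<bar>L2_norm a - L2_norm b\<bar> \<le> L2_norm (\<lambda>x. a x - b x)"
  using L2_norm_diff_triangle[OF a b square_integrable_zero] L2_norm_diff_triangle[OF b a square_integrable_zero]
    L2_norm_minus_commute[of a b] by simp

lemma ball_part_tendsto:
  assumes g: "square_integrable g"
  shows "((\<lambda>R. L2_norm (\<lambda>x. g x - ball_part R g x)) \<longlongrightarrow> 0) at_top"
proof -
  note [measurable] = square_integrableD(1)[OF g]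
  have [measurable]: "ball_part R g \<in> borel_measurable borel" for R
    using square_integrableD(1)[OF ball_part(1)[OF g]] .
  have "((\<lambda>R. LINT x|lborel. (cmod (g x - ball_part R g x))\<^sup>2) \<longlongrightarrow> (LINT x::'a|lborel. 0)) at_top"
  proof (rule integral_dominated_convergence_at_top[where w="\<lambda>x. (cmod (g x))\<^sup>2"])
    show "\<forall>\<^sub>F R in at_top. AE x in lborel. norm ((cmod (g x - ball_part R g x))\<^sup>2) \<le> (cmod (g x))\<^sup>2"
      by (auto simp: ball_part_def split: split_indicator)
    show "AE x in lborel. ((\<lambda>R. (cmod (g x - ball_part R g x))\<^sup>2) \<longlongrightarrow> 0) at_top"
    proof (rule AE_I2)
      fix x
      have "\<forall>\<^sub>F R in at_top. (cmod (g x - ball_part R g x))\<^sup>2 = 0"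
        using eventually_ge_at_top[of "norm x"] by eventually_elim (simp add: ball_part_def)
      then show "((\<lambda>R. (cmod (g x - ball_part R g x))\<^sup>2) \<longlongrightarrow> 0) at_top" by (rule tendsto_eventually)
    qed
  qed (use square_integrableD(2)[OF g] in auto)
  from tendsto_real_sqrt[OF this] show ?thesis by (simp add: L2_norm_def)
qed

text \<open>
  Each truncated transform is square integrable, so the extended integral in the definition is the
  square of a genuine \<open>L\<^sup>2\<close> distance.
\<close>
lemma has_fourier_transform_iff:
  "has_fourier_transform g h \<longleftrightarrow> square_integrable g \<and> square_integrable h \<and>
    ((\<lambda>R. L2_norm (\<lambda>\<xi>. h \<xi> - truncated_fourier R g \<xi>)) \<longlongrightarrow> 0) at_top"
proof -
  have "((\<lambda>R. \<integral>\<^sup>+ \<xi>. ennreal ((cmod (h \<xi> - truncated_fourier R g \<xi>))\<^sup>2) \<partial>lborel) \<longlongrightarrow> 0) at_top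
    \<longleftrightarrow> ((\<lambda>R. L2_norm (\<lambda>\<xi>. h \<xi> - truncated_fourier R g \<xi>)) \<longlongrightarrow> 0) at_top"
    if g: "square_integrable g" and h: "square_integrable h"
  proof -
    let ?L = "\<lambda>R. L2_norm (\<lambda>\<xi>. h \<xi> - truncated_fourier R g \<xi>)"
    have "((\<lambda>R. \<integral>\<^sup>+ \<xi>. ennreal ((cmod (h \<xi> - truncated_fourier R g \<xi>))\<^sup>2) \<partial>lborel) \<longlongrightarrow> 0) at_top
      \<longleftrightarrow> ((\<lambda>R. ennreal ((?L R)\<^sup>2)) \<longlongrightarrow> ennreal 0) at_top"
      by (simp add: nn_integral_cmod_power2[OF square_integrable_diff[OF h Plancherel_truncated(1)[OF g]]])
    also have "\<dots> \<longleftrightarrow> ((\<lambda>R. (?L R)\<^sup>2) \<longlongrightarrow> 0) at_top"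
      by (rule tendsto_ennreal_iff) auto
    also have "\<dots> \<longleftrightarrow> (?L \<longlongrightarrow> 0) at_top"
      using tendsto_real_sqrt[of "\<lambda>R. (?L R)\<^sup>2" 0 at_top] tendsto_power[of ?L 0 at_top 2] by auto
    finally show ?thesis .
  qed
  then show ?thesis unfolding has_fourier_transform_def by blast
qed

text \<open>
  By Plancherel for the cut-off functions the truncated transforms inherit the Cauchy property from
  the parts of \<open>g\<close> in balls. Completeness gives a limit along integer radii, and the same estimate
  extends the convergence to real radii.
\<close>
lemma fourier_transform_exists:
  fixes g :: "'a::euclidean_space \<Rightarrow> complex"
  assumes g: "square_integrable g"
  shows "\<exists>h. has_fourier_transform g h"
proof -
  let ?T = "\<lambda>R. truncated_fourier R g"
  let ?t = "\<lambda>R. L2_norm (\<lambda>x. g x - ball_part R g x)"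
  note T = Plancherel_truncated(1)[OF g]
  have TT: "L2_norm (\<lambda>\<xi>. ?T R \<xi> - ?T S \<xi>) \<le> ?t R + ?t S" for R S
    unfolding Plancherel_truncated(3)[OF g]
    using L2_norm_diff_triangle[OF ball_part(1)[OF g] g ball_part(1)[OF g], of R S]
      L2_norm_minus_commute[of g "ball_part R g"] by simp
  have tail: "\<exists>N. \<forall>R\<ge>N. ?t R < e" if "0 < e" for e
    using order_tendstoD(2)[OF ball_part_tendsto[OF g] that] by (simp add: eventually_at_top_linorder)
  have "\<exists>h. square_integrable h \<and> (\<lambda>k. L2_norm (\<lambda>\<xi>. h \<xi> - ?T (real k) \<xi>)) \<longlonglongrightarrow> 0"
  proof (rule L2_complete[OF T])
    fix e :: real assume "0 < e"
    then obtain N where N: "\<And>R. N \<le> R \<Longrightarrow> ?t R < e / 2" using tail[of "e / 2"] by auto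
    have "L2_norm (\<lambda>\<xi>. ?T (real m) \<xi> - ?T (real n) \<xi>) \<le> e" if "nat \<lceil>N\<rceil> \<le> m" "nat \<lceil>N\<rceil> \<le> n" for m n
      using TT[of "real m" "real n"] N[of "real m"] N[of "real n"] that by linarith
    then show "\<exists>N. \<forall>m\<ge>N. \<forall>n\<ge>N. L2_norm (\<lambda>\<xi>. ?T (real m) \<xi> - ?T (real n) \<xi>) \<le> e" by blast
  qed
  then obtain h where h: "square_integrable h" and lim: "(\<lambda>k. L2_norm (\<lambda>\<xi>. h \<xi> - ?T (real k) \<xi>)) \<longlonglongrightarrow> 0"
    by blast
  have "((\<lambda>R. L2_norm (\<lambda>\<xi>. h \<xi> - ?T R \<xi>)) \<longlongrightarrow> 0) at_top"
  proof (rule order_tendstoI)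
    fix e :: real assume "0 < e"
    then obtain N where N: "\<And>R. N \<le> R \<Longrightarrow> ?t R < e / 3" using tail[of "e / 3"] by auto
    obtain K where K: "\<And>k. K \<le> k \<Longrightarrow> L2_norm (\<lambda>\<xi>. h \<xi> - ?T (real k) \<xi>) < e / 3"
      using order_tendstoD(2)[OF lim, of "e / 3"] \<open>0 < e\<close> by (auto simp: eventually_sequentially)
    let ?k = "max K (nat \<lceil>N\<rceil>)"
    have "N \<le> real ?k" by linarith
    have "L2_norm (\<lambda>\<xi>. h \<xi> - ?T R \<xi>) < e" if "N \<le> R" for R
      using L2_norm_diff_triangle[OF h T[of "real ?k"] T[of R]] TT[of "real ?k" R] K[of ?k]
        N[OF \<open>N \<le> real ?k\<close>] N[OF that] by simp
    then show "\<forall>\<^sub>F R in at_top. L2_norm (\<lambda>\<xi>. h \<xi> - ?T R \<xi>) < e"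
      by (auto simp: eventually_at_top_linorder)
  next
    fix e :: real assume "e < 0"
    then show "\<forall>\<^sub>F R in at_top. e < L2_norm (\<lambda>\<xi>. h \<xi> - ?T R \<xi>)"
      by (simp add: order_less_le_trans[OF _ L2_norm_nonneg])
  qed
  with g h show ?thesis by (auto simp: has_fourier_transform_iff)
qed

lemma has_fourier_transform_fourier_transform:
  "square_integrable g \<Longrightarrow> has_fourier_transform g (fourier_transform g)"
  unfolding fourier_transform_def by (rule someI_ex[OF fourier_transform_exists])

lemma has_fourier_transform_diff:
  assumes a: "has_fourier_transform a a'" and b: "has_fourier_transform b b'"
  shows "has_fourier_transform (\<lambda>x. a x - b x) (\<lambda>\<xi>. a' \<xi> - b' \<xi>)"
proof -
  note A = a[unfolded has_fourier_transform_iff] and B = b[unfolded has_fourier_transform_iff]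
  then have sq: "square_integrable a" "square_integrable b" "square_integrable a'" "square_integrable b'" by auto
  let ?Ta = "\<lambda>R. truncated_fourier R a" and ?Tb = "\<lambda>R. truncated_fourier R b"
  have T: "truncated_fourier R (\<lambda>x. a x - b x) = (\<lambda>\<xi>. ?Ta R \<xi> - ?Tb R \<xi>)" for R
  proof -
    have "ball_part R (\<lambda>x. a x - b x) = (\<lambda>x. ball_part R a x - ball_part R b x)"
      by (simp add: ball_part_def fun_eq_iff right_diff_distrib)
    then show ?thesis
      by (intro ext) (simp only: truncated_fourier_eq fourier_integral_diff[OF ball_part(2)[OF sq(1)] ball_part(2)[OF sq(2)]])
  qed
  have "((\<lambda>R. L2_norm (\<lambda>\<xi>. a' \<xi> - b' \<xi> - truncated_fourier R (\<lambda>x. a x - b x) \<xi>)) \<longlongrightarrow> 0) at_top"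
  proof (rule tendsto_sandwich[OF _ _ tendsto_const])
    show "((\<lambda>R. L2_norm (\<lambda>\<xi>. a' \<xi> - ?Ta R \<xi>) + L2_norm (\<lambda>\<xi>. b' \<xi> - ?Tb R \<xi>)) \<longlongrightarrow> 0) at_top"
      using tendsto_add[OF conjunct2[OF conjunct2[OF A]] conjunct2[OF conjunct2[OF B]]] by simp
    have "L2_norm (\<lambda>\<xi>. a' \<xi> - b' \<xi> - truncated_fourier R (\<lambda>x. a x - b x) \<xi>)
        \<le> L2_norm (\<lambda>\<xi>. a' \<xi> - ?Ta R \<xi>) + L2_norm (\<lambda>\<xi>. b' \<xi> - ?Tb R \<xi>)" for R
      using L2_norm_triangle[OF square_integrable_diff[OF sq(3) Plancherel_truncated(1)[OF sq(1), of R]]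
          square_integrable_diff[OF Plancherel_truncated(1)[OF sq(2), of R] sq(4)]]
        L2_norm_minus_commute[of b' "?Tb R"]
      by (simp add: T algebra_simps)
    then show "\<forall>\<^sub>F R in at_top. L2_norm (\<lambda>\<xi>. a' \<xi> - b' \<xi> - truncated_fourier R (\<lambda>x. a x - b x) \<xi>)
        \<le> L2_norm (\<lambda>\<xi>. a' \<xi> - ?Ta R \<xi>) + L2_norm (\<lambda>\<xi>. b' \<xi> - ?Tb R \<xi>)" by simp
  qed simp
  then show ?thesis using sq by (simp add: has_fourier_transform_iff square_integrable_diff)
qed

text \<open>
  Both \<open>L2_norm h\<close> and \<open>L2_norm g\<close> are limits of the common value
  \<open>L2_norm (truncated_fourier R g) = L2_norm (ball_part R g)\<close>.
\<close>
lemma Plancherel: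
  assumes "has_fourier_transform g h"
  shows "L2_norm h = L2_norm g"
proof -
  have g: "square_integrable g" and h: "square_integrable h"
    and lim: "((\<lambda>R. L2_norm (\<lambda>\<xi>. h \<xi> - truncated_fourier R g \<xi>)) \<longlongrightarrow> 0) at_top"
    using assms by (auto simp: has_fourier_transform_iff)
  have "((\<lambda>R. L2_norm h - L2_norm (ball_part R g)) \<longlongrightarrow> 0) at_top"
    by (rule Lim_null_comparison[OF _ lim])
       (simp add: abs_L2_norm_diff_le[OF h Plancherel_truncated(1)[OF g]] flip: Plancherel_truncated(2)[OF g])
  moreover have "((\<lambda>R. L2_norm g - L2_norm (ball_part R g)) \<longlongrightarrow> 0) at_top"
    by (rule Lim_null_comparison[OF _ ball_part_tendsto[OF g]])
       (simp add: abs_L2_norm_diff_le[OF g ball_part(1)[OF g]])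
  ultimately have "((\<lambda>R::real. L2_norm h - L2_norm g) \<longlongrightarrow> 0 - 0) at_top"
    using tendsto_diff by fastforce
  then show ?thesis by (simp add: tendsto_const_iff)
qed

text \<open>
  The difference of the transforms is a transform of a null function, so it has norm 0. With
  \<open>a = b\<close> this is the uniqueness of the transform up to null sets.
\<close>
lemma fourier_transform_cong_AE:
  assumes "has_fourier_transform a a'" "has_fourier_transform b b'" "AE x in lborel. a x = b x"
  shows "AE \<xi> in lborel. a' \<xi> = b' \<xi>"
proof -
  note d = has_fourier_transform_diff[OF assms(1,2)]
  then have sq: "square_integrable (\<lambda>x. a x - b x)" "square_integrable (\<lambda>\<xi>. a' \<xi> - b' \<xi>)"
    by (auto simp: has_fourier_transform_def)
  have "L2_norm (\<lambda>x. a x - b x) = L2_norm (\<lambda>x::'a. 0)"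
    by (rule L2_norm_cong_AE) (use sq assms(3) in \<open>auto simp: square_integrable_def\<close>)
  then have "L2_norm (\<lambda>\<xi>. a' \<xi> - b' \<xi>) = 0"
    using Plancherel[OF d] by (simp add: L2_norm_def)
  from L2_norm_eq_zero_imp_AE[OF sq(2) this] show ?thesis by simp
qed

section \<open>The source problem in frequency space\<close>

text \<open>
  The quantity \<open>exp (z t) \<cdot> (z w(t) - F)\<close> has derivative 0, hence keeps its initial value \<open>-F\<close>.
  Continuity up to time 0 is what links the equation on \<open>t > 0\<close> to the initial value.
\<close>
lemma linear_ode_terminal_value:
  fixes z F :: complex and w :: "real \<Rightarrow> complex"
  assumes cont: "continuous_on {0..} w"
    and ode: "\<And>t. 0 < t \<Longrightarrow> (w has_vector_derivative - z * w t + F) (at t)"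
    and init: "w 0 = 0" and t: "0 < t"
  shows "z * w t = (1 - exp (- (z * complex_of_real t))) * F"
proof -
  define \<phi> where "\<phi> s = exp (z * complex_of_real s) * (z * w s - F)" for s
  have "\<phi> t = - F"
  proof (rule has_derivative_zero_unique_strong_interval[of "{0}" 0 t])
    show "continuous_on {0..t} \<phi>"
      unfolding \<phi>_def by (intro continuous_intros continuous_on_subset[OF cont]) auto
    fix s assume s: "s \<in> {0..t} - {0}"
    have "((\<lambda>c. exp (z * c)) has_field_derivative z * exp (z * complex_of_real s)) (at (complex_of_real s))"
      by (auto intro!: derivative_eq_intros simp: mult.commute)
    then have d1: "((\<lambda>s. exp (z * complex_of_real s)) has_vector_derivative z * exp (z * complex_of_real s)) (at s)"
      by (rule has_vector_derivative_real_field)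
    have d2: "((\<lambda>s. z * w s - F) has_vector_derivative z * (- z * w s + F) - 0) (at s)"
      by (rule has_vector_derivative_diff[OF has_vector_derivative_mult_right[OF ode] has_vector_derivative_const])
         (use s in auto)
    have "exp (z * complex_of_real s) * (z * (- z * w s + F) - 0)
        + z * exp (z * complex_of_real s) * (z * w s - F) = 0"
      by (simp add: algebra_simps)
    then have "(\<phi> has_vector_derivative 0) (at s)"
      using has_vector_derivative_mult[OF d1 d2] by (simp only: \<phi>_def[abs_def])
    then show "(\<phi> has_derivative (\<lambda>h. 0)) (at s within {0..t})"
      by (simp add: has_vector_derivative_def has_derivative_at_withinI)
  qed (use t in \<open>auto simp: \<phi>_def init\<close>)
  then have "exp (- (z * complex_of_real t)) * (exp (z * complex_of_real t) * (z * w t - F))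
      = exp (- (z * complex_of_real t)) * (- F)"
    by (simp add: \<phi>_def)
  then have "z * w t - F = exp (- (z * complex_of_real t)) * (- F)"
    by (simp add: exp_minus mult.assoc[symmetric])
  then show ?thesis by (simp add: algebra_simps)
qed

text \<open>
  With \<open>x = Re z \<cdot> t\<close>, the denominator has modulus at least \<open>1 - exp (-x) \<ge> x/(1 + x)\<close>, by
  \<open>exp x \<ge> 1 + x\<close>.
\<close>
lemma norm_div_one_minus_exp_le:
  assumes z: "0 < Re z" and t: "0 < t"
  shows "1 - exp (- (z * complex_of_real t)) \<noteq> 0"
    and "cmod (z / (1 - exp (- (z * complex_of_real t)))) \<le> cmod z * (1 + 1 / (Re z * t))"
proof -
  let ?a = "Re z * t"
  have a: "0 < ?a" using z t by simp
  have "exp (- ?a) \<le> 1 / (1 + ?a)"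
    using exp_ge_add_one_self[of ?a] a by (simp add: exp_minus divide_simps)
  then have "?a / (1 + ?a) \<le> 1 - exp (- ?a)" using a by (simp add: field_simps)
  also have "\<dots> = cmod 1 - cmod (exp (- (z * complex_of_real t)))" by (simp add: norm_exp_eq_Re)
  also have "\<dots> \<le> cmod (1 - exp (- (z * complex_of_real t)))" by (rule norm_triangle_ineq2)
  finally have low: "?a / (1 + ?a) \<le> cmod (1 - exp (- (z * complex_of_real t)))" .
  moreover have pos: "0 < ?a / (1 + ?a)" using a by simp
  ultimately show "1 - exp (- (z * complex_of_real t)) \<noteq> 0" by force
  have "cmod (z / (1 - exp (- (z * complex_of_real t)))) \<le> cmod z / (?a / (1 + ?a))"
    unfolding norm_divide
    by (rule divide_left_mono[OF low norm_ge_zero mult_pos_pos[OF less_le_trans[OF pos low] pos]])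
  also have "\<dots> = cmod z * (1 + 1 / ?a)" using z t by (simp add: field_simps)
  finally show "cmod (z / (1 - exp (- (z * complex_of_real t)))) \<le> cmod z * (1 + 1 / ?a)" .
qed

lemma Re_symbol_z: "Re (symbol_z \<alpha> \<beta> \<nu> \<xi>) = \<alpha>\<^sup>2 * (norm \<xi>)\<^sup>2 + \<nu>"
  by (simp add: symbol_z_def)

text \<open>
  With \<open>a = Re z\<close> and \<open>\<bar>Im z\<bar> \<le> q\<close>, the previous bound gives
  \<open>(a + q)(1 + 1/(a t)) = (1/t + q/(a t)) + (a + q)\<close>. Since \<open>\<parallel>\<xi>\<parallel> \<le> (1 + \<parallel>\<xi>\<parallel>\<^sup>2)/2\<close>, one may take
  \<open>q = S (1 + \<parallel>\<xi>\<parallel>\<^sup>2)/2\<close>, and each of the two groups is at most \<open>M (1 + \<parallel>\<xi>\<parallel>\<^sup>2)\<close>; this is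
  where the two entries of the maximum in the theorem come from.
\<close>
lemma norm_Lambda_le:
  fixes \<beta> \<xi> :: "'a::euclidean_space"
  assumes \<nu>: "0 < \<nu>" and t: "0 < t" and S: "norm \<beta> \<le> S"
    and M: "1 / t + S / (2 * \<nu> * t) \<le> M" "\<nu> + \<alpha>\<^sup>2 + S / 2 \<le> M"
  shows "cmod (Lambda \<alpha> \<beta> \<nu> t \<xi>) \<le> 2 * M * (1 + (norm \<xi>)\<^sup>2)"
proof -
  let ?z = "symbol_z \<alpha> \<beta> \<nu> \<xi>" and ?s = "(norm \<xi>)\<^sup>2"
  define a where "a = \<alpha>\<^sup>2 * ?s + \<nu>"
  have a: "\<nu> \<le> a" "0 < a" using \<nu> by (auto simp: a_def add_nonneg_pos)
  have S0: "0 \<le> S" using S norm_ge_zero order_trans by blast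
  define q where "q = S * (1 + ?s) / 2"
  have q0: "0 \<le> q" using S0 by (simp add: q_def)
  have "\<bar>\<beta> \<bullet> \<xi>\<bar> \<le> norm \<beta> * norm \<xi>" by (rule Cauchy_Schwarz_ineq2)
  also have "\<dots> \<le> S * ((1 + ?s) / 2)"
    using S S0 sum_squares_bound[of 1 "norm \<xi>"] by (intro mult_mono) auto
  finally have bq: "\<bar>\<beta> \<bullet> \<xi>\<bar> \<le> q" by (simp add: q_def)
  have "cmod ?z \<le> \<bar>Re ?z\<bar> + \<bar>Im ?z\<bar>" by (rule cmod_le)
  also have "\<dots> \<le> a + q" using bq a by (simp add: symbol_z_def a_def)
  finally have z: "cmod ?z \<le> a + q" .
  have "cmod (Lambda \<alpha> \<beta> \<nu> t \<xi>) \<le> cmod ?z * (1 + 1 / (a * t))"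
    using norm_div_one_minus_exp_le(2)[of ?z t] a t by (simp add: Lambda_def Re_symbol_z a_def)
  also have "\<dots> \<le> (a + q) * (1 + 1 / (a * t))" using z a t by (intro mult_right_mono) auto
  also have "\<dots> = (1 / t + q / (a * t)) + (a + q)" using a t by (simp add: field_simps)
  also have "q / (a * t) \<le> q / (\<nu> * t)" using a \<nu> t q0 by (intro divide_left_mono mult_right_mono) auto
  also have "1 / t + q / (\<nu> * t) \<le> (1 / t + S / (2 * \<nu> * t)) * (1 + ?s)"
  proof -
    have "q / (\<nu> * t) = S / (2 * \<nu> * t) * (1 + ?s)" by (simp add: q_def)
    moreover have "1 / t * 1 \<le> 1 / t * (1 + ?s)" using t by (intro mult_left_mono) auto
    ultimately show ?thesis by (simp only: distrib_right mult_1_right)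
  qed
  also have "\<dots> \<le> M * (1 + ?s)" using M by (intro mult_right_mono) auto
  also have "a + q \<le> (\<nu> + \<alpha>\<^sup>2 + S / 2) * (1 + ?s)"
    using \<nu> by (simp add: a_def q_def field_simps)
  also have "\<dots> \<le> M * (1 + ?s)" using M by (intro mult_right_mono) auto
  finally show ?thesis by (simp add: algebra_simps)
qed

section \<open>Filter bounds and choice of the parameter\<close>

lemma filter_noise_le:
  fixes \<mu> s :: real
  assumes "0 < \<mu>" "\<mu>\<^sup>2 \<le> 1" "0 \<le> s"
  shows "(1 + s) / (1 + \<mu>\<^sup>2 * s) \<le> 1 / \<mu>\<^sup>2"
  using assms by (simp add: divide_simps add_pos_nonneg algebra_simps)

text \<open>
  With \<open>x = \<mu>\<^sup>2 s\<close>: for \<open>p \<le> 2\<close> the factor \<open>x/(1 + x)\<close> is at most \<open>x\<^bsup>p/2\<^esup>\<close>, which produces \<open>\<mu>\<^sup>p\<close>;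
  for \<open>p > 2\<close> the filter saturates and only \<open>x/(1 + x) \<le> x\<close> remains, which produces \<open>\<mu>\<^sup>2\<close>.
\<close>
lemma filter_bias_le:
  fixes \<mu> s p :: real
  assumes \<mu>: "0 < \<mu>" and s: "0 \<le> s" and p: "0 < p"
  shows "\<mu>\<^sup>2 * s / (1 + \<mu>\<^sup>2 * s) \<le> max (\<mu> powr p) (\<mu>\<^sup>2) * (1 + s) powr (p / 2)"
proof (cases "p \<le> 2")
  case True
  let ?x = "\<mu>\<^sup>2 * s"
  have x: "0 \<le> ?x" using s by simp
  have "?x / (1 + ?x) \<le> ?x powr (p / 2)"
  proof (cases "?x \<le> 1")
    case le: True
    have "?x / (1 + ?x) \<le> ?x" using x by (simp add: divide_simps distrib_left)
    also have "?x \<le> ?x powr (p / 2)"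
      using powr_mono'[of "p / 2" 1 ?x] x le True p by (cases "?x = 0") auto
    finally show ?thesis .
  next
    case False
    then have "?x / (1 + ?x) \<le> 1" by simp
    also have "1 \<le> ?x powr (p / 2)" using False p by (intro ge_one_powr_ge_zero) auto
    finally show ?thesis .
  qed
  also have "\<dots> = \<mu> powr p * s powr (p / 2)"
    using \<mu> s by (simp add: powr_mult powr_powr flip: powr_numeral)
  also have "\<dots> \<le> max (\<mu> powr p) (\<mu>\<^sup>2) * (1 + s) powr (p / 2)"
    using s p by (intro mult_mono powr_mono2) (auto simp: le_max_iff_disj)
  finally show ?thesis .
next
  case False
  have "\<mu>\<^sup>2 * s / (1 + \<mu>\<^sup>2 * s) \<le> \<mu>\<^sup>2 * s" using s by (simp add: divide_simps distrib_left add_pos_nonneg)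
  also have "\<dots> \<le> max (\<mu> powr p) (\<mu>\<^sup>2) * (1 + s) powr (p / 2)"
  proof (intro mult_mono)
    have "s \<le> (1 + s) powr 1" using s by simp
    also have "\<dots> \<le> (1 + s) powr (p / 2)" using s False by (intro powr_mono) auto
    finally show "s \<le> (1 + s) powr (p / 2)" .
  qed (use s in \<open>auto simp: le_max_iff_disj\<close>)
  finally show ?thesis .
qed

text \<open>
  The parameter balances the two errors: with \<open>r = \<delta>/C\<close> both \<open>\<delta>/\<mu>\<^sup>2\<close> and \<open>C \<mu>\<^sup>p\<close> equal
  \<open>r\<^bsup>p/(p+2)\<^esup> C\<close>. The second entry of the maximum is the saturated bias \<open>C \<mu>\<^sup>2\<close> relative to that.
\<close>
lemma parameter_choice:
  fixes \<delta> C p \<mu> :: real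
  assumes \<delta>: "0 < \<delta>" and C: "0 < C" and p: "0 < p" and \<mu>: "0 < \<mu>" "\<mu>\<^sup>2 = (\<delta> / C) powr (2 / (p + 2))"
  defines "K \<equiv> \<delta> powr (p / (p + 2)) * C powr (2 / (p + 2))"
  shows "\<delta> / \<mu>\<^sup>2 = K"
    and "max (\<mu> powr p) (\<mu>\<^sup>2) * C = K * max 1 ((\<delta> / C) powr ((2 - p) / (p + 2)))"
proof -
  define r where "r = \<delta> / C"
  have r: "0 < r" "\<delta> = r * C" using \<delta> C by (auto simp: r_def)
  have e: "p / (p + 2) + 2 / (p + 2) = 1" using p by (simp add: field_simps flip: add_divide_distrib)
  have K: "K = r powr (p / (p + 2)) * C"
  proof -
    have "K = r powr (p / (p + 2)) * (C powr (p / (p + 2)) * C powr (2 / (p + 2)))"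
      using r C by (simp add: K_def powr_mult)
    also have "C powr (p / (p + 2)) * C powr (2 / (p + 2)) = C"
      using C e by (simp flip: powr_add)
    finally show ?thesis .
  qed
  have "r / \<mu>\<^sup>2 = r powr (1 - 2 / (p + 2))"
    unfolding \<mu>(2) r_def[symmetric] using r(1) by (simp add: powr_diff)
  also have "1 - 2 / (p + 2) = p / (p + 2)" using e by simp
  finally have "r / \<mu>\<^sup>2 * C = K" by (simp only: K)
  then show "\<delta> / \<mu>\<^sup>2 = K" by (simp add: r(2))
  have "\<mu> = (\<mu> powr 2) powr (1 / 2)" using \<mu>(1) by (simp add: powr_powr del: powr_numeral)
  also have "\<mu> powr 2 = r powr (2 / (p + 2))" using \<mu> by (simp add: r_def)
  finally have "\<mu> powr p = r powr (2 / (p + 2) * (1 / 2) * p)" by (simp only: powr_powr)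
  also have "2 / (p + 2) * (1 / 2) * p = p / (p + 2)" using p by (simp add: field_simps)
  finally have \<mu>p: "\<mu> powr p = r powr (p / (p + 2))" .
  have "\<mu>\<^sup>2 = r powr (p / (p + 2)) * r powr ((2 - p) / (p + 2))"
    unfolding \<mu>(2) r_def[symmetric] by (simp flip: powr_add add_divide_distrib)
  then have "max (\<mu> powr p) (\<mu>\<^sup>2) = r powr (p / (p + 2)) * max 1 (r powr ((2 - p) / (p + 2)))"
    by (simp add: \<mu>p max_mult_distrib_left)
  then show "max (\<mu> powr p) (\<mu>\<^sup>2) * C = K * max 1 ((\<delta> / C) powr ((2 - p) / (p + 2)))"
    by (simp add: K r_def mult_ac)
qed

text \<open>
  The regular representatives \<open>v\<close> solve the equation for almost every frequency; at the two times 0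
  and \<open>t\<close> they agree almost everywhere with the transforms of 0 and of \<open>y\<close>, which supplies the
  initial and the terminal value.
\<close>
lemma source_transform_eq_Lambda:
  fixes \<beta> :: "'a::euclidean_space"
  assumes \<nu>: "0 < \<nu>" and t: "0 < t" and y: "square_integrable y"
    and sol: "solves_source_problem \<alpha> \<beta> \<nu> t u f y"
  shows "AE \<xi> in lborel. fourier_transform f \<xi> = Lambda \<alpha> \<beta> \<nu> t \<xi> * fourier_transform y \<xi>"
proof -
  obtain v where v: "\<And>s. 0 \<le> s \<Longrightarrow> AE \<xi> in lborel. v s \<xi> = fourier_transform (u s) \<xi>"
    and ode: "AE \<xi> in lborel. continuous_on {0..} (\<lambda>t. v t \<xi>) \<and>
      (\<forall>t>0. ((\<lambda>s. v s \<xi>) has_vector_derivative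
        - symbol_z \<alpha> \<beta> \<nu> \<xi> * v t \<xi> + fourier_transform f \<xi>) (at t))"
    using sol by (auto simp: solves_source_problem_def)
  have u: "has_fourier_transform (u s) (fourier_transform (u s))" if "0 \<le> s" for s
    using sol that by (intro has_fourier_transform_fourier_transform) (simp add: solves_source_problem_def)
  have zero: "has_fourier_transform (\<lambda>_::'a. 0) (\<lambda>_. 0)"
    by (simp add: has_fourier_transform_def truncated_fourier_def set_lebesgue_integral_def)
  have "AE \<xi> in lborel. fourier_transform (u 0) \<xi> = 0"
    by (rule fourier_transform_cong_AE[OF u zero]) (use sol in \<open>auto simp: solves_source_problem_def\<close>)
  moreover have "AE \<xi> in lborel. fourier_transform (u t) \<xi> = fourier_transform y \<xi>"
    by (rule fourier_transform_cong_AE[OF u has_fourier_transform_fourier_transform[OF y]])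
       (use sol t in \<open>auto simp: solves_source_problem_def\<close>)
  moreover have "AE \<xi> in lborel. v t \<xi> = fourier_transform (u t) \<xi>" using v[of t] t by simp
  ultimately show ?thesis using v[OF order_refl] ode
  proof eventually_elim
    case (elim \<xi>)
    let ?z = "symbol_z \<alpha> \<beta> \<nu> \<xi>"
    have z: "0 < Re ?z" using \<nu> by (simp add: Re_symbol_z add_nonneg_pos)
    have "?z * v t \<xi> = (1 - exp (- (?z * complex_of_real t))) * fourier_transform f \<xi>"
      by (rule linear_ode_terminal_value) (use elim t in auto)
    then show ?case
      using norm_div_one_minus_exp_le(1)[OF z t] elim by (simp add: Lambda_def divide_simps mult.commute)
  qed
qed

theorem theorem2:
  fixes \<alpha> \<nu> t\<^sub>0 \<delta> \<delta>\<^sub>M \<mu> C p M :: real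
    and \<beta> :: "real ^ 'n"
    and u :: "real \<Rightarrow> real ^ 'n \<Rightarrow> complex"
    and f y y\<^sub>\<delta> f\<^sub>\<delta>\<^sub>\<mu> :: "real ^ 'n \<Rightarrow> complex"
  assumes "\<alpha>\<^sup>2 > 0" and "\<nu> > 0" and "t\<^sub>0 > 0"
    and "square_integrable f" and "square_integrable y" and "square_integrable y\<^sub>\<delta>"
    and "solves_source_problem \<alpha> \<beta> \<nu> t\<^sub>0 u f y"
    and "0 < \<delta>" and "\<delta> \<le> \<delta>\<^sub>M"
    and "L2_norm (\<lambda>x. y x - y\<^sub>\<delta> x) \<le> \<delta>"
    and "has_fourier_transform f\<^sub>\<delta>\<^sub>\<mu>
           (\<lambda>\<xi>. Lambda \<alpha> \<beta> \<nu> t\<^sub>0 \<xi> / complex_of_real (1 + \<mu>\<^sup>2 * (norm \<xi>)\<^sup>2)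
                 * fourier_transform y\<^sub>\<delta> \<xi>)"
    and "0 < p" and "in_sobolev_space p f" and "sobolev_norm p f < C"
    and "\<delta> \<le> C"
    and "\<mu> > 0" and "\<mu>\<^sup>2 = (\<delta> / C) powr (2 / (p + 2))"
    and "M = max (1 / t\<^sub>0 + sqrt (real CARD('n)) * infnorm \<beta> / (2 * \<nu> * t\<^sub>0))
                 (\<nu> + \<alpha>\<^sup>2 + sqrt (real CARD('n)) * infnorm \<beta> / 2)"
  shows "L2_norm (\<lambda>x. f x - f\<^sub>\<delta>\<^sub>\<mu> x)
           \<le> 2 * \<delta> powr (p / (p + 2)) * C powr (2 / (p + 2))
               * (M + 1 / 2 * max 1 ((\<delta> / C) powr ((2 - p) / (p + 2))))"
proof -
  have C: "0 < C" using assms by linarith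
  let ?F = "fourier_transform f" and ?Y = "fourier_transform y" and ?Y\<delta> = "fourier_transform y\<^sub>\<delta>"
  let ?L = "Lambda \<alpha> \<beta> \<nu> t\<^sub>0"
  let ?w = "\<lambda>\<xi>::real ^ 'n. 1 + \<mu>\<^sup>2 * (norm \<xi>)\<^sup>2"
  let ?G = "\<lambda>\<xi>. ?L \<xi> / complex_of_real (?w \<xi>) * ?Y\<delta> \<xi>"
  let ?m = "max (\<mu> powr p) (\<mu>\<^sup>2)"
  note hF = has_fourier_transform_fourier_transform[OF \<open>square_integrable f\<close>]
  note hY = has_fourier_transform_diff[OF has_fourier_transform_fourier_transform[OF \<open>square_integrable y\<close>]
    has_fourier_transform_fourier_transform[OF \<open>square_integrable y\<^sub>\<delta>\<close>]]
  note hD = has_fourier_transform_diff[OF hF \<open>has_fourier_transform f\<^sub>\<delta>\<^sub>\<mu> _\<close>]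
  have F: "square_integrable ?F" and dY: "square_integrable (\<lambda>\<xi>. ?Y \<xi> - ?Y\<delta> \<xi>)"
    and D: "square_integrable (\<lambda>\<xi>. ?F \<xi> - ?G \<xi>)"
    using hF hY hD by (auto simp: has_fourier_transform_def)
  note [measurable] = square_integrableD(1)[OF F] square_integrableD(1)[OF dY]
  have [measurable]: "?L \<in> borel_measurable borel"
    unfolding Lambda_def symbol_z_def by measurable
  have w: "0 < ?w \<xi>" for \<xi> by (simp add: add_pos_nonneg)
  \<comment> \<open>The bias \<open>?b\<close> is what the filter does to exact data, \<open>?e\<close> the propagated data error.\<close>
  let ?b = "\<lambda>\<xi>. complex_of_real (\<mu>\<^sup>2 * (norm \<xi>)\<^sup>2 / ?w \<xi>) * ?F \<xi>"
  let ?e = "\<lambda>\<xi>. ?L \<xi> / complex_of_real (?w \<xi>) * (?Y \<xi> - ?Y\<delta> \<xi>)"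
  let ?W = "\<lambda>\<xi>. complex_of_real ((1 + (norm \<xi>)\<^sup>2) powr (p / 2)) * ?F \<xi>"
  have W_sq: "(cmod (?W \<xi>))\<^sup>2 = (cmod (?F \<xi>))\<^sup>2 * (1 + (norm \<xi>)\<^sup>2) powr p" for \<xi>
    by (simp add: norm_mult power_mult_distrib mult.commute power2_eq_square flip: powr_add)
  have W: "square_integrable ?W" and W_norm: "L2_norm ?W = sobolev_norm p f"
    using \<open>in_sobolev_space p f\<close>
    by (auto simp: square_integrable_def in_sobolev_space_def L2_norm_def sobolev_norm_def W_sq)
  have "cmod (?b \<xi>) \<le> ?m * cmod (?W \<xi>)" for \<xi>
  proof -
    have "0 \<le> \<mu>\<^sup>2 * (norm \<xi>)\<^sup>2 / ?w \<xi>" using w[of \<xi>] by (intro divide_nonneg_pos) auto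
    then have "cmod (?b \<xi>) = \<mu>\<^sup>2 * (norm \<xi>)\<^sup>2 / ?w \<xi> * cmod (?F \<xi>)"
      by (simp only: norm_mult norm_of_real abs_of_nonneg)
    also have "\<dots> \<le> ?m * (1 + (norm \<xi>)\<^sup>2) powr (p / 2) * cmod (?F \<xi>)"
      by (rule mult_right_mono[OF filter_bias_le]) (use assms in auto)
    finally show ?thesis by (simp add: norm_mult mult.assoc)
  qed
  then have b_le: "AE \<xi> in lborel. cmod (?b \<xi>) \<le> ?m * cmod (?W \<xi>)" by simp
  have m0: "0 \<le> ?m" by (simp add: le_max_iff_disj)
  have "?b \<in> borel_measurable borel" by measurable
  note b = square_integrable_dominated[OF W this b_le m0]
  have S: "norm \<beta> \<le> sqrt (real CARD('n)) * infnorm \<beta>"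
    using norm_le_infnorm[of \<beta>] by simp
  have \<mu>1: "\<mu>\<^sup>2 \<le> 1" unfolding assms(17) using assms C by (intro powr_le1) auto
  have M0: "0 \<le> M" using assms(2,3) by (simp add: assms(18) le_max_iff_disj infnorm_pos_le add_nonneg_nonneg)
  have "cmod (?e \<xi>) \<le> 2 * M / \<mu>\<^sup>2 * cmod (?Y \<xi> - ?Y\<delta> \<xi>)" for \<xi>
  proof -
    have "cmod (?e \<xi>) = cmod (?L \<xi>) / ?w \<xi> * cmod (?Y \<xi> - ?Y\<delta> \<xi>)"
      unfolding norm_mult norm_divide norm_of_real using w[of \<xi>] by simp
    also have "\<dots> \<le> 2 * M * (1 + (norm \<xi>)\<^sup>2) / ?w \<xi> * cmod (?Y \<xi> - ?Y\<delta> \<xi>)"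
      by (intro mult_right_mono divide_right_mono norm_Lambda_le[OF assms(2,3) S]) (auto simp: assms(18) w less_imp_le)
    also have "\<dots> \<le> 2 * M * (1 / \<mu>\<^sup>2) * cmod (?Y \<xi> - ?Y\<delta> \<xi>)"
      unfolding times_divide_eq_right[symmetric]
      using filter_noise_le[OF \<open>\<mu> > 0\<close> \<mu>1, of "(norm \<xi>)\<^sup>2"] M0
      by (intro mult_right_mono mult_left_mono) auto
    finally show ?thesis by simp
  qed
  then have e_le: "AE \<xi> in lborel. cmod (?e \<xi>) \<le> 2 * M / \<mu>\<^sup>2 * cmod (?Y \<xi> - ?Y\<delta> \<xi>)" by simp
  have c0: "0 \<le> 2 * M / \<mu>\<^sup>2" using M0 by simp
  have "?e \<in> borel_measurable borel" by measurable
  note e = square_integrable_dominated[OF dY this e_le c0]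
  have split: "AE \<xi> in lborel. ?F \<xi> - ?G \<xi> = ?b \<xi> + ?e \<xi>"
    using source_transform_eq_Lambda[OF assms(2,3,5,7)]
  proof eventually_elim
    case (elim \<xi>)
    have "\<mu>\<^sup>2 * (norm \<xi>)\<^sup>2 / ?w \<xi> = 1 - 1 / ?w \<xi>"
      using w[of \<xi>] by (simp add: field_simps)
    then have "complex_of_real (\<mu>\<^sup>2 * (norm \<xi>)\<^sup>2 / ?w \<xi>) = 1 - 1 / complex_of_real (?w \<xi>)"
      by (simp only: of_real_diff of_real_1 of_real_divide)
    then show ?case unfolding elim by (simp only: left_diff_distrib right_diff_distrib) simp
  qed
  have "L2_norm (\<lambda>x. f x - f\<^sub>\<delta>\<^sub>\<mu> x) = L2_norm (\<lambda>\<xi>. ?F \<xi> - ?G \<xi>)"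
    using Plancherel[OF hD] by simp
  also have "\<dots> = L2_norm (\<lambda>\<xi>. ?b \<xi> + ?e \<xi>)"
    by (rule L2_norm_cong_AE[OF square_integrableD(1)[OF D]
          square_integrableD(1)[OF square_integrable_add[OF b(1) e(1)]] split])
  also have "\<dots> \<le> L2_norm ?b + L2_norm ?e" by (rule L2_norm_triangle[OF b(1) e(1)])
  also have "L2_norm ?b \<le> ?m * C"
    using b(2) mult_left_mono[OF less_imp_le[OF \<open>sobolev_norm p f < C\<close>] m0]
    unfolding W_norm by (rule order_trans)
  also have "L2_norm ?e \<le> 2 * M / \<mu>\<^sup>2 * \<delta>"
    using e(2) mult_left_mono[OF assms(10) c0] unfolding Plancherel[OF hY] by (rule order_trans)
  also have "2 * M / \<mu>\<^sup>2 * \<delta> = 2 * M * (\<delta> / \<mu>\<^sup>2)" by simp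
  finally show ?thesis
    unfolding parameter_choice[OF \<open>0 < \<delta>\<close> C \<open>0 < p\<close> \<open>0 < \<mu>\<close> assms(17)]
    by (simp add: algebra_simps)
qed

end
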